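(* Let $R$ be a ring (associative, with $1$), and let $w_0, v_0\colon U_0\to U_1$ be homomorphisms of left $R$-modules with $w_0$ injective. Let $H$ be the cokernel of $w_0$, and let $K$ and $Q$ be the kernel and the cokernel of $v_0$, respectively. Let $U_i$, $w_i, v_i\colon U_i\to U_{i+1}$ ($i\ge 0$) be the ladder constructed from $(w_0,v_0)$ by iterated pushouts, and let $U_\infty=\bigcup_i U_i$ be the inductive limit along the maps $w_i$ (as described in the context). Then: (a) The maps $v_i$ yield a map $v_\infty\colon U_\infty\to U_\infty$ with kernel (isomorphic to) $K$ and cokernel (isomorphic to) $Q$. (b) The map $v_\infty$ induces an isomorphism $\overline v\colon U_\infty/U_0\to U_\infty/U_1$. Let $p\colon U_\infty/U_0\to U_\infty/U_1$ be the canonical projection and let $\phi=\overline v^{-1}\circ p$, an endomorphism of $U_\infty/U_0$. If $H$ is non-zero and of finite length, then $U_\infty/U_0$ is a Prüfer module with respect to $\phi$, with basis $H$ (that is, $\phi$ is surjective and locally nilpotent, and its kernel is isomorphic to $H$).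
   Context: A non-zero $R$-module $P$ is called a Prüfer module (with respect to $\phi$) if $\phi$ is a surjective, locally nilpotent endomorphism of $P$ whose kernel has finite length; locally nilpotent means that for every $x\in P$ there is $t\ge 1$ with $\phi^t(x)=0$. The kernel of $\phi$ is called the basis. Ladder construction: given $w_0,v_0\colon U_0\to U_1$ with $w_0$ injective, define inductively modules $U_{i+2}$ and maps $w_{i+1},v_{i+1}\colon U_{i+1}\to U_{i+2}$ by forming the pushout of $w_i\colon U_i\to U_{i+1}$ and $v_i\colon U_i\to U_{i+1}$, so that $$v_{i+1}w_i=w_{i+1}v_i$$ is a pushout square; here $w_{i+1}$ is the map parallel to $w_i$ and $v_{i+1}$ is the map parallel to $v_i$. All $w_i$ are injective with cokernel isomorphic to $H$, and all $v_i$ have kernel isomorphic to $K$ and cokernel isomorphic to $Q$. The module $U_\infty$ is the direct limit of $U_0\xrightarrow{w_0}U_1\xrightarrow{w_1}U_2\to\cdots$, and each $U_i$ is regarded as a submodule of $U_\infty$ (and of $U_{i+1}$ via $w_i$). Since $v_{i+1}w_i=w_{i+1}v_i$ for all $i$, the maps $v_i$ induce an endomorphism $v_\infty$ of $U_\infty$, which maps $U_i$ into $U_{i+1}$ by $v_i$. *)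

theory Defs
  imports "HOL-Algebra.QuotRing" "HOL-Algebra.Module"
begin

section \<open>Left modules over an arbitrary ring\<close>

text \<open>
  The library locale \<^locale>\<open>module\<close> requires a commutative ring of scalars. The
  following locale has the same axioms over an arbitrary associative ring with 1. In a record of
  type \<open>('r, 'm) module\<close> the inherited fields \<open>mult\<close> and \<open>one\<close> play no role.
  The library locale \<^locale>\<open>submodule\<close> does not use commutativity of the scalars and is
  used as it is.
\<close>

locale left_module = R?: ring + M?: abelian_group M for M (structure) +
  assumes smult_closed:
      "\<lbrakk> a \<in> carrier R; x \<in> carrier M \<rbrakk> \<Longrightarrow> a \<odot>\<^bsub>M\<^esub> x \<in> carrier M"
    and smult_l_distr:
      "\<lbrakk> a \<in> carrier R; b \<in> carrier R; x \<in> carrier M \<rbrakk> \<Longrightarrow>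
        (a \<oplus> b) \<odot>\<^bsub>M\<^esub> x = a \<odot>\<^bsub>M\<^esub> x \<oplus>\<^bsub>M\<^esub> b \<odot>\<^bsub>M\<^esub> x"
    and smult_r_distr:
      "\<lbrakk> a \<in> carrier R; x \<in> carrier M; y \<in> carrier M \<rbrakk> \<Longrightarrow>
        a \<odot>\<^bsub>M\<^esub> (x \<oplus>\<^bsub>M\<^esub> y) = a \<odot>\<^bsub>M\<^esub> x \<oplus>\<^bsub>M\<^esub> a \<odot>\<^bsub>M\<^esub> y"
    and smult_assoc1:
      "\<lbrakk> a \<in> carrier R; b \<in> carrier R; x \<in> carrier M \<rbrakk> \<Longrightarrow>
        (a \<otimes> b) \<odot>\<^bsub>M\<^esub> x = a \<odot>\<^bsub>M\<^esub> (b \<odot>\<^bsub>M\<^esub> x)"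
    and smult_one:
      "x \<in> carrier M \<Longrightarrow> \<one> \<odot>\<^bsub>M\<^esub> x = x"

definition module_hom ::
    "('r, 'k) ring_scheme \<Rightarrow> ('r, 'm) module \<Rightarrow> ('r, 'n) module \<Rightarrow> ('m \<Rightarrow> 'n) set" where
  "module_hom R M N =
     {f \<in> carrier M \<rightarrow> carrier N.
        (\<forall>x\<in>carrier M. \<forall>y\<in>carrier M. f (x \<oplus>\<^bsub>M\<^esub> y) = f x \<oplus>\<^bsub>N\<^esub> f y) \<and>
        (\<forall>a\<in>carrier R. \<forall>x\<in>carrier M. f (a \<odot>\<^bsub>M\<^esub> x) = a \<odot>\<^bsub>N\<^esub> f x)}"

definition module_iso ::
    "('r, 'k) ring_scheme \<Rightarrow> ('r, 'm) module \<Rightarrow> ('r, 'n) module \<Rightarrow> ('m \<Rightarrow> 'n) set" where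
  "module_iso R M N = {f \<in> module_hom R M N. bij_betw f (carrier M) (carrier N)}"

definition module_isomorphic ::
    "('r, 'k) ring_scheme \<Rightarrow> ('r, 'm) module \<Rightarrow> ('r, 'n) module \<Rightarrow> bool" where
  "module_isomorphic R M N \<longleftrightarrow> module_iso R M N \<noteq> {}"

definition quotient_module :: "('r, 'm) module \<Rightarrow> 'm set \<Rightarrow> ('r, 'm set) module" where
  "quotient_module M N =
     \<lparr>carrier = a_rcosets\<^bsub>M\<^esub> N,
      mult = undefined,
      one = undefined,
      zero = N,
      add = set_add M,
      smult = (\<lambda>a X. \<Union>x\<in>X. N +>\<^bsub>M\<^esub> (a \<odot>\<^bsub>M\<^esub> x))\<rparr>"

definition kernel_module ::
    "('r, 'm) module \<Rightarrow> ('r, 'n) module \<Rightarrow> ('m \<Rightarrow> 'n) \<Rightarrow> ('r, 'm) module" where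
  "kernel_module M N f = M\<lparr>carrier := a_kernel M N f\<rparr>"

definition cokernel_module ::
    "('r, 'm) module \<Rightarrow> ('r, 'n) module \<Rightarrow> ('m \<Rightarrow> 'n) \<Rightarrow> ('r, 'n set) module" where
  "cokernel_module M N f = quotient_module N (f ` carrier M)"

text \<open>
  The map \<open>M/M' \<rightarrow> N/N'\<close>, \<open>M' + x \<mapsto> N' + f x\<close>, induced by \<open>f\<close> when \<open>f\<close> maps \<open>M'\<close> into \<open>N'\<close>;
  the source \<open>M\<close> and \<open>M'\<close> enter only through the cosets \<open>X\<close> to which the map is applied.
\<close>

definition induced_map :: "('r, 'n) module \<Rightarrow> 'n set \<Rightarrow> ('m \<Rightarrow> 'n) \<Rightarrow> 'm set \<Rightarrow> 'n set" where
  "induced_map N N' f X = (\<Union>x\<in>X. N' +>\<^bsub>N\<^esub> f x)"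


section \<open>Finite length and Pruefer modules\<close>

definition simple_module :: "('r, 'k) ring_scheme \<Rightarrow> ('r, 'm) module \<Rightarrow> bool" where
  "simple_module R M \<longleftrightarrow>
     left_module R M \<and> carrier M \<noteq> {\<zero>\<^bsub>M\<^esub>} \<and>
     (\<forall>N. submodule N R M \<longrightarrow> N = {\<zero>\<^bsub>M\<^esub>} \<or> N = carrier M)"

text \<open>Finite length means that there is a composition series \<open>N 0 \<subseteq> \<dots> \<subseteq> N n\<close>.\<close>

definition finite_length :: "('r, 'k) ring_scheme \<Rightarrow> ('r, 'm) module \<Rightarrow> bool" where
  "finite_length R M \<longleftrightarrow>
     left_module R M \<and>
     (\<exists>(n::nat) N.
        N 0 = {\<zero>\<^bsub>M\<^esub>} \<and> N n = carrier M \<and>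
        (\<forall>i\<le>n. submodule (N i) R M) \<and>
        (\<forall>i<n. N i \<subseteq> N (Suc i) \<and>
           simple_module R (quotient_module (M\<lparr>carrier := N (Suc i)\<rparr>) (N i))))"

definition locally_nilpotent :: "('r, 'm) module \<Rightarrow> ('m \<Rightarrow> 'm) \<Rightarrow> bool" where
  "locally_nilpotent P \<phi> \<longleftrightarrow> (\<forall>x\<in>carrier P. \<exists>t\<ge>1. (\<phi> ^^ t) x = \<zero>\<^bsub>P\<^esub>)"

definition pruefer_module ::
    "('r, 'k) ring_scheme \<Rightarrow> ('r, 'm) module \<Rightarrow> ('m \<Rightarrow> 'm) \<Rightarrow> bool" where
  "pruefer_module R P \<phi> \<longleftrightarrow>
     left_module R P \<and> carrier P \<noteq> {\<zero>\<^bsub>P\<^esub>} \<and>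
     \<phi> \<in> module_hom R P P \<and>
     \<phi> ` carrier P = carrier P \<and>
     locally_nilpotent P \<phi> \<and>
     finite_length R (kernel_module P P \<phi>)"


section \<open>Pushouts and ladders\<close>

text \<open>
  \<open>is_pushout R A B C D f g h k\<close>: the square with \<open>f : A \<rightarrow> B\<close>, \<open>g : A \<rightarrow> C\<close>, \<open>h : B \<rightarrow> D\<close>,
  \<open>k : C \<rightarrow> D\<close> commutes and is universal. The type of the test modules \<open>T\<close> has to be fixed, and
  \<open>('m \<times> 'm) set\<close> loses nothing: it accommodates the standard pushout
  \<open>(B \<oplus> C) / {(f a, - g a) | a \<in> A}\<close> (whose elements are cosets) and, via
  \<open>d \<mapsto> {(d, d)}\<close>, a copy of \<open>D\<close> itself, so the usual uniqueness argument shows that \<open>D\<close> is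
  isomorphic to the standard pushout, compatibly with the maps from \<open>B\<close> and \<open>C\<close>.
\<close>

definition is_pushout ::
    "('r, 'k) ring_scheme \<Rightarrow> ('r, 'm) module \<Rightarrow> ('r, 'm) module \<Rightarrow> ('r, 'm) module \<Rightarrow>
     ('r, 'm) module \<Rightarrow> ('m \<Rightarrow> 'm) \<Rightarrow> ('m \<Rightarrow> 'm) \<Rightarrow> ('m \<Rightarrow> 'm) \<Rightarrow> ('m \<Rightarrow> 'm) \<Rightarrow> bool" where
  "is_pushout R A B C D f g h k \<longleftrightarrow>
     (\<forall>a\<in>carrier A. h (f a) = k (g a)) \<and>
     (\<forall>(T :: ('r, ('m \<times> 'm) set) module) b c.
        left_module R T \<longrightarrow> b \<in> module_hom R B T \<longrightarrow> c \<in> module_hom R C T \<longrightarrow>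
        (\<forall>a\<in>carrier A. b (f a) = c (g a)) \<longrightarrow>
          (\<exists>d \<in> module_hom R D T.
             (\<forall>y\<in>carrier B. d (h y) = b y) \<and> (\<forall>z\<in>carrier C. d (k z) = c z) \<and>
             (\<forall>d' \<in> module_hom R D T.
                (\<forall>y\<in>carrier B. d' (h y) = b y) \<and> (\<forall>z\<in>carrier C. d' (k z) = c z) \<longrightarrow>
                (\<forall>x\<in>carrier D. d' x = d x))))"

text \<open>
  The ladder is determined by \<open>w 0\<close> and \<open>v 0\<close> up to isomorphism. All \<open>U i\<close> share one carrier
  type \<open>'m\<close>; for given \<open>w 0\<close> and \<open>v 0\<close> there is a ladder as soon as \<open>'m\<close> is large enough.
\<close>

locale ladder = ring R for R (structure) +
  fixes U :: "nat \<Rightarrow> ('a, 'm) module"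
    and w v :: "nat \<Rightarrow> 'm \<Rightarrow> 'm"
  assumes left_module: "left_module R (U i)"
    and w_hom: "w i \<in> module_hom R (U i) (U (Suc i))"
    and v_hom: "v i \<in> module_hom R (U i) (U (Suc i))"
    and w_0_inj: "inj_on (w 0) (carrier (U 0))"
    and pushout: "is_pushout R (U i) (U (Suc i)) (U (Suc i)) (U (Suc (Suc i)))
                    (w i) (v i) (v (Suc i)) (w (Suc i))"


section \<open>Direct limit of a sequence of modules\<close>

fun seq_map :: "(nat \<Rightarrow> 'm \<Rightarrow> 'm) \<Rightarrow> nat \<Rightarrow> nat \<Rightarrow> 'm \<Rightarrow> 'm" where
  "seq_map w i 0 x = x"
| "seq_map w i (Suc n) x = w (i + n) (seq_map w i n x)"

text \<open>
  The class of \<open>x \<in> U i\<close> in the direct limit of \<open>U 0 \<rightarrow> U 1 \<rightarrow> \<dots>\<close>: all \<open>y \<in> U j\<close> that agree with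
  \<open>x\<close> in some later \<open>U (i + m) = U (j + n)\<close>. As a function of \<open>x\<close> this is the canonical map from
  \<open>U i\<close> to the limit.
\<close>

definition limit_map ::
    "(nat \<Rightarrow> ('r, 'm) module) \<Rightarrow> (nat \<Rightarrow> 'm \<Rightarrow> 'm) \<Rightarrow> nat \<Rightarrow> 'm \<Rightarrow> (nat \<times> 'm) set" where
  "limit_map U w i x =
     {(j, y). y \<in> carrier (U j) \<and>
        (\<exists>m n. i + m = j + n \<and> seq_map w i m x = seq_map w j n y)}"

definition limit_module ::
    "(nat \<Rightarrow> ('r, 'm) module) \<Rightarrow> (nat \<Rightarrow> 'm \<Rightarrow> 'm) \<Rightarrow> ('r, (nat \<times> 'm) set) module" where
  "limit_module U w =
     \<lparr>carrier = (\<Union>i. limit_map U w i ` carrier (U i)),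
      mult = undefined,
      one = undefined,
      zero = limit_map U w 0 \<zero>\<^bsub>U 0\<^esub>,
      add = (\<lambda>X Y. \<Union>{limit_map U w i (x \<oplus>\<^bsub>U i\<^esub> y) | i x y. (i, x) \<in> X \<and> (i, y) \<in> Y}),
      smult = (\<lambda>a X. \<Union>{limit_map U w i (a \<odot>\<^bsub>U i\<^esub> x) | i x. (i, x) \<in> X})\<rparr>"

text \<open>\<open>U i\<close> regarded as a submodule of the limit.\<close>

definition limit_part ::
    "(nat \<Rightarrow> ('r, 'm) module) \<Rightarrow> (nat \<Rightarrow> 'm \<Rightarrow> 'm) \<Rightarrow> nat \<Rightarrow> (nat \<times> 'm) set set" where
  "limit_part U w i = limit_map U w i ` carrier (U i)"

text \<open>The endomorphism of the limit given by the maps \<open>v i : U i \<rightarrow> U (i + 1)\<close>.\<close>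

definition limit_endo ::
    "(nat \<Rightarrow> ('r, 'm) module) \<Rightarrow> (nat \<Rightarrow> 'm \<Rightarrow> 'm) \<Rightarrow> (nat \<Rightarrow> 'm \<Rightarrow> 'm) \<Rightarrow>
     (nat \<times> 'm) set \<Rightarrow> (nat \<times> 'm) set" where
  "limit_endo U w v X = \<Union>{limit_map U w (Suc i) (v i x) | i x. (i, x) \<in> X}"

end

theory Submission
  imports Defs
begin

text \<open>
  Two properties of the pushout square of \<open>w i\<close> and \<open>v i\<close> carry the proof: \<open>U (i + 2)\<close> is the sum of
  \<open>v (U (i + 1))\<close> and \<open>w (U (i + 1))\<close> (\<open>pushout_cover\<close>), and \<open>v y = w z\<close> holds only if \<open>y = w a\<close> and
  \<open>z = v a\<close> for a common \<open>a \<in> U i\<close> (\<open>pushout_exact\<close>). Each is obtained by testing the universal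
  property on one quotient of a direct sum. The second one shows that all \<open>w i\<close> are injective, so
  that the \<open>U i\<close> form an increasing sequence of submodules of the limit.

  Going through this filtration, the two properties say that in the limit \<open>U\<^sub>\<infinity>\<close>, with endomorphism \<open>v\<close>,
   \<^item> \<open>U\<^sub>\<infinity> = U 1 + v U\<^sub>\<infinity>\<close>, and more precisely \<open>U (i + 1) = U 1 + v (U i)\<close>
    (\<open>part_Suc_cover\<close>, \<open>limit_cover\<close>),
   \<^item> \<open>v x \<in> U 1\<close> exactly for \<open>x \<in> U 0\<close> (\<open>v_limit_part_1_iff\<close>).

  Everything follows from these two facts and from \<open>v\<close> being \<open>v 0\<close> on \<open>U 0\<close>. The kernel of \<open>v\<close> lies in
  \<open>U 0\<close>, hence is that of \<open>v 0\<close>; the image of \<open>v\<close> spans the limit together with \<open>U 1\<close> and meets \<open>U 1\<close>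
  in \<open>v 0 (U 0)\<close>, hence has the cokernel of \<open>v 0\<close>; and \<open>v\<close> induces an isomorphism from \<open>U\<^sub>\<infinity>/U 0\<close> to
  \<open>U\<^sub>\<infinity>/U 1\<close>. The isomorphisms between quotients are instances of
  \<open>induced_map_iso\<close>. Finally, \<open>\<phi>\<close> sends the class of
  \<open>z + v y\<close> with \<open>z \<in> U 1\<close> to the class of \<open>y\<close> (\<open>shift_coset\<close>). So \<open>\<phi>\<close> is surjective, it maps
  \<open>U (i + 1)/U 0\<close> to \<open>U i/U 0\<close>, which makes it locally nilpotent, and its kernel is \<open>U 1/U 0\<close>, a copy
  of the cokernel of \<open>w 0\<close>.
\<close>

section \<open>Submodules and homomorphisms over an arbitrary ring\<close>

context left_module
begin

lemma smult_r_zero: "a \<in> carrier R \<Longrightarrow> a \<odot>\<^bsub>M\<^esub> \<zero>\<^bsub>M\<^esub> = \<zero>\<^bsub>M\<^esub>"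
  using smult_r_distr[of a "\<zero>\<^bsub>M\<^esub>" "\<zero>\<^bsub>M\<^esub>"] smult_closed[of a "\<zero>\<^bsub>M\<^esub>"]
  by (metis M.add.l_cancel_one M.l_zero M.zero_closed)

lemma smult_l_zero: "x \<in> carrier M \<Longrightarrow> \<zero> \<odot>\<^bsub>M\<^esub> x = \<zero>\<^bsub>M\<^esub>"
  using smult_l_distr[of "\<zero>" "\<zero>" x] smult_closed[of "\<zero>" x]
  by (metis M.add.l_cancel_one R.l_zero R.zero_closed)

lemma smult_minus_one:
  assumes "x \<in> carrier M"
  shows "(\<ominus> \<one>) \<odot>\<^bsub>M\<^esub> x = \<ominus>\<^bsub>M\<^esub> x"
proof (rule M.minus_equality[symmetric])
  show "(\<ominus> \<one>) \<odot>\<^bsub>M\<^esub> x \<oplus>\<^bsub>M\<^esub> x = \<zero>\<^bsub>M\<^esub>"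
    using smult_l_distr[of "\<ominus> \<one>" "\<one>" x] smult_one[OF assms] smult_l_zero[OF assms] assms
    by (simp add: R.l_neg)
qed (use assms smult_closed in auto)

lemma smult_uminus:
  assumes "a \<in> carrier R" and "x \<in> carrier M"
  shows "a \<odot>\<^bsub>M\<^esub> (\<ominus>\<^bsub>M\<^esub> x) = \<ominus>\<^bsub>M\<^esub> (a \<odot>\<^bsub>M\<^esub> x)"
proof (rule M.minus_equality[symmetric])
  show "a \<odot>\<^bsub>M\<^esub> (\<ominus>\<^bsub>M\<^esub> x) \<oplus>\<^bsub>M\<^esub> a \<odot>\<^bsub>M\<^esub> x = \<zero>\<^bsub>M\<^esub>"
    using smult_r_distr[of a "\<ominus>\<^bsub>M\<^esub> x" x] assms by (simp add: M.l_neg smult_r_zero)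
qed (use assms smult_closed in auto)

lemma minus_zero_right: "x \<in> carrier M \<Longrightarrow> x \<ominus>\<^bsub>M\<^esub> \<zero>\<^bsub>M\<^esub> = x"
  using M.minus_equality[of "\<zero>\<^bsub>M\<^esub>" "\<zero>\<^bsub>M\<^esub>"] by (simp add: a_minus_def)

lemma minus_eq_zero_iff:
  assumes "x \<in> carrier M" and "y \<in> carrier M"
  shows "x \<ominus>\<^bsub>M\<^esub> y = \<zero>\<^bsub>M\<^esub> \<longleftrightarrow> x = y"
  using assms M.minus_equality[of x "\<ominus>\<^bsub>M\<^esub> y"] M.r_neg[of y] by (auto simp: a_minus_def)

text \<open>Closure under negatives is automatic, because \<open>-x = (-1) x\<close>.\<close>

lemma submodule_iff:
  "submodule A R M \<longleftrightarrow> A \<subseteq> carrier M \<and> \<zero>\<^bsub>M\<^esub> \<in> A \<and> (\<forall>x\<in>A. \<forall>y\<in>A. x \<oplus>\<^bsub>M\<^esub> y \<in> A) \<and>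
     (\<forall>a\<in>carrier R. \<forall>x\<in>A. a \<odot>\<^bsub>M\<^esub> x \<in> A)" (is "_ \<longleftrightarrow> ?rhs")
proof
  assume "submodule A R M"
  then interpret A: submodule A R M .
  show ?rhs
    using A.subset A.one_closed A.m_closed A.smult_closed by auto
next
  assume A: ?rhs
  have inv: "\<ominus>\<^bsub>M\<^esub> x \<in> A" if x: "x \<in> A" for x
  proof -
    have "\<ominus> \<one> \<in> carrier R"
      by simp
    with A x have *: "(\<ominus> \<one>) \<odot>\<^bsub>M\<^esub> x \<in> A"
      by blast
    have "x \<in> carrier M"
      using A x by blast
    from * show ?thesis
      unfolding smult_minus_one[OF \<open>x \<in> carrier M\<close>] .
  qed
  show "submodule A R M"
  proof (rule submodule.intro)
    show "subgroup A (add_monoid M)"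
      by (rule M.add.subgroupI) (use A inv in \<open>auto simp: a_inv_def[symmetric]\<close>)
    show "submodule_axioms A R M"
      by (rule submodule_axioms.intro) (use A in blast)
  qed
qed

lemma submoduleI:
  assumes "A \<subseteq> carrier M" and "\<zero>\<^bsub>M\<^esub> \<in> A"
    and "\<And>x y. x \<in> A \<Longrightarrow> y \<in> A \<Longrightarrow> x \<oplus>\<^bsub>M\<^esub> y \<in> A"
    and "\<And>a x. a \<in> carrier R \<Longrightarrow> x \<in> A \<Longrightarrow> a \<odot>\<^bsub>M\<^esub> x \<in> A"
  shows "submodule A R M"
  unfolding submodule_iff using assms by auto

lemma submodule_carrier: "submodule (carrier M) R M"
  by (rule submoduleI) (auto intro: smult_closed)

lemma submodule_subset: "submodule A R M \<Longrightarrow> A \<subseteq> carrier M"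
  and submodule_zero: "submodule A R M \<Longrightarrow> \<zero>\<^bsub>M\<^esub> \<in> A"
  and submodule_add: "\<lbrakk>submodule A R M; x \<in> A; y \<in> A\<rbrakk> \<Longrightarrow> x \<oplus>\<^bsub>M\<^esub> y \<in> A"
  and submodule_smult: "\<lbrakk>submodule A R M; a \<in> carrier R; x \<in> A\<rbrakk> \<Longrightarrow> a \<odot>\<^bsub>M\<^esub> x \<in> A"
  by (simp_all add: submodule_iff)

lemma submodule_uminus:
  assumes "submodule A R M" and "x \<in> A"
  shows "\<ominus>\<^bsub>M\<^esub> x \<in> A"
  using submodule_smult[OF assms(1) _ assms(2), of "\<ominus> \<one>"] smult_minus_one[of x]
    submodule_subset[OF assms(1)] assms(2) by auto

lemma submodule_left_module:
  assumes A: "submodule A R M"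
  shows "left_module R (M\<lparr>carrier := A\<rparr>)"
proof (intro left_module.intro left_module_axioms.intro abelian_groupI R.ring_axioms)
  fix x assume "x \<in> carrier (M\<lparr>carrier := A\<rparr>)"
  then have x: "x \<in> A" "x \<in> carrier M"
    using submodule_subset[OF A] by auto
  show "\<exists>y\<in>carrier (M\<lparr>carrier := A\<rparr>). y \<oplus>\<^bsub>M\<lparr>carrier := A\<rparr>\<^esub> x = \<zero>\<^bsub>M\<lparr>carrier := A\<rparr>\<^esub>"
    by (rule bexI[of _ "\<ominus>\<^bsub>M\<^esub> x"]) (use x submodule_uminus[OF A] in \<open>simp_all add: M.l_neg\<close>)
qed (use submodule_subset[OF A] submodule_zero[OF A] in
    \<open>auto simp: submodule_add[OF A] submodule_smult[OF A] subset_iff M.a_ac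
      smult_l_distr smult_r_distr smult_assoc1 smult_one\<close>)

lemma submodule_restrict:
  assumes "submodule A R M" and "submodule B R M" and "A \<subseteq> B"
  shows "submodule A R (M\<lparr>carrier := B\<rparr>)"
  using assms(3) submodule_zero[OF assms(1)] submodule_add[OF assms(1)] submodule_smult[OF assms(1)]
  by (intro left_module.submoduleI[OF submodule_left_module[OF assms(2)]]) auto

end

lemma module_homI:
  assumes "\<And>x. x \<in> carrier M \<Longrightarrow> f x \<in> carrier N"
    and "\<And>x y. \<lbrakk>x \<in> carrier M; y \<in> carrier M\<rbrakk> \<Longrightarrow> f (x \<oplus>\<^bsub>M\<^esub> y) = f x \<oplus>\<^bsub>N\<^esub> f y"
    and "\<And>a x. \<lbrakk>a \<in> carrier R; x \<in> carrier M\<rbrakk> \<Longrightarrow> f (a \<odot>\<^bsub>M\<^esub> x) = a \<odot>\<^bsub>N\<^esub> f x"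
  shows "f \<in> module_hom R M N"
  using assms by (auto simp: module_hom_def)

lemma module_hom_closed: "\<lbrakk>f \<in> module_hom R M N; x \<in> carrier M\<rbrakk> \<Longrightarrow> f x \<in> carrier N"
  and module_hom_add:
    "\<lbrakk>f \<in> module_hom R M N; x \<in> carrier M; y \<in> carrier M\<rbrakk> \<Longrightarrow> f (x \<oplus>\<^bsub>M\<^esub> y) = f x \<oplus>\<^bsub>N\<^esub> f y"
  and module_hom_smult:
    "\<lbrakk>f \<in> module_hom R M N; a \<in> carrier R; x \<in> carrier M\<rbrakk> \<Longrightarrow> f (a \<odot>\<^bsub>M\<^esub> x) = a \<odot>\<^bsub>N\<^esub> f x"
  by (auto simp: module_hom_def)

lemma module_hom_comp:
  "\<lbrakk>f \<in> module_hom R L M; g \<in> module_hom R M N\<rbrakk> \<Longrightarrow> g \<circ> f \<in> module_hom R L N"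
  by (auto simp: module_hom_def Pi_iff)

lemma module_hom_restrict:
  assumes "f \<in> module_hom R M N" and "A \<subseteq> carrier M" and "f ` A \<subseteq> B"
  shows "f \<in> module_hom R (M\<lparr>carrier := A\<rparr>) (N\<lparr>carrier := B\<rparr>)"
  using assms by (auto simp: module_hom_def image_subset_iff subset_iff)

lemma module_isoI:
  assumes "f \<in> module_hom R M N" and "inj_on f (carrier M)"
    and "\<And>y. y \<in> carrier N \<Longrightarrow> \<exists>x\<in>carrier M. y = f x"
  shows "f \<in> module_iso R M N"
  using assms by (auto simp: module_iso_def bij_betw_def dest: module_hom_closed)

lemma module_iso_hom: "f \<in> module_iso R M N \<Longrightarrow> f \<in> module_hom R M N"
  and module_iso_bij: "f \<in> module_iso R M N \<Longrightarrow> bij_betw f (carrier M) (carrier N)"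
  by (auto simp: module_iso_def)

lemma module_iso_inv:
  assumes "left_module R M" and f: "f \<in> module_iso R M N"
  shows "inv_into (carrier M) f \<in> module_iso R N M"
proof -
  interpret M: left_module R M by fact
  let ?g = "inv_into (carrier M) f"
  note bij = module_iso_bij[OF f] and hom = module_iso_hom[OF f]
  have inj: "inj_on f (carrier M)"
    using bij by (rule bij_betw_imp_inj_on)
  have g: "?g y \<in> carrier M" "f (?g y) = y" if "y \<in> carrier N" for y
    using that bij by (auto simp: bij_betw_def inv_into_into f_inv_into_f)
  have g_eqI: "?g y = x" if "x \<in> carrier M" "f x = y" for x y
    using that inj by auto
  have "?g \<in> module_hom R N M"
    by (rule module_homI)
      (auto simp: g module_hom_add[OF hom] module_hom_smult[OF hom] M.smult_closed intro!: g_eqI)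
  with bij show ?thesis
    by (simp add: module_iso_def bij_betw_inv_into)
qed

lemma module_isomorphic_sym:
  "\<lbrakk>left_module R M; module_isomorphic R M N\<rbrakk> \<Longrightarrow> module_isomorphic R N M"
  unfolding module_isomorphic_def using module_iso_inv by fastforce

section \<open>Quotient modules and induced maps\<close>

text \<open>
  Scalar multiplication on a quotient and \<open>induced_map\<close> are both defined as the union, over all
  representatives, of values that do not depend on the representative.
\<close>

lemma UN_coset:
  assumes "A \<noteq> {}" and "\<And>a. a \<in> A \<Longrightarrow> g (a \<oplus>\<^bsub>M\<^esub> x) = g x"
  shows "(\<Union>y\<in>A +>\<^bsub>M\<^esub> x. g y) = g x"
  using assms by (auto simp: a_r_coset_def')

lemma quotient_carrier: "carrier (quotient_module M A) = (\<lambda>x. A +>\<^bsub>M\<^esub> x) ` carrier M"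
  by (auto simp: quotient_module_def A_RCOSETS_def')

lemma quotient_zero: "\<zero>\<^bsub>quotient_module M A\<^esub> = A"
  by (simp add: quotient_module_def)

context left_module
begin

lemma submodule_abelian_subgroup: "submodule A R M \<Longrightarrow> abelian_subgroup A M"
  by (intro abelian_subgroupI3 additive_subgroupI) (auto intro: submodule.axioms M.abelian_group_axioms)

lemma coset_eq_iff:
  assumes A: "submodule A R M" and x: "x \<in> carrier M" and y: "y \<in> carrier M"
  shows "A +>\<^bsub>M\<^esub> x = A +>\<^bsub>M\<^esub> y \<longleftrightarrow> x \<ominus>\<^bsub>M\<^esub> y \<in> A"
proof -
  interpret A: abelian_subgroup A M
    by (rule submodule_abelian_subgroup[OF A])
  have "A +>\<^bsub>M\<^esub> x = A +>\<^bsub>M\<^esub> y \<longleftrightarrow> x \<in> A +>\<^bsub>M\<^esub> y"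
    using A.a_repr_independence'[of x y] A.a_rcos_self[of x] x y by auto
  then show ?thesis
    using A.a_rcos_module[of y x] x y by (simp add: a_minus_def)
qed

lemma coset_zero: "submodule A R M \<Longrightarrow> A +>\<^bsub>M\<^esub> \<zero>\<^bsub>M\<^esub> = A"
  by (simp add: submodule_subset)

lemma coset_zero_iff: "\<lbrakk>submodule A R M; x \<in> carrier M\<rbrakk> \<Longrightarrow> A +>\<^bsub>M\<^esub> x = A \<longleftrightarrow> x \<in> A"
  using coset_eq_iff[of A x "\<zero>\<^bsub>M\<^esub>"] by (simp add: coset_zero minus_zero_right)

lemma coset_absorb:
  "\<lbrakk>submodule A R M; a \<in> A; x \<in> carrier M\<rbrakk> \<Longrightarrow> A +>\<^bsub>M\<^esub> (a \<oplus>\<^bsub>M\<^esub> x) = A +>\<^bsub>M\<^esub> x"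
  using submodule_subset[of A]
  by (subst coset_eq_iff) (auto simp: a_minus_def M.a_assoc M.r_neg)

end

text \<open>
  Quotient modules are formed of module records without further fields. The following locale is
  \<^locale>\<open>left_module\<close> at that type.
\<close>

locale plain_module = left_module R M for R :: "('r, 'k) ring_scheme" and M :: "('r, 'm) module"
begin

lemma quotient_add:
  "\<lbrakk>submodule A R M; x \<in> carrier M; y \<in> carrier M\<rbrakk> \<Longrightarrow>
    (A +>\<^bsub>M\<^esub> x) \<oplus>\<^bsub>quotient_module M A\<^esub> (A +>\<^bsub>M\<^esub> y) = A +>\<^bsub>M\<^esub> (x \<oplus>\<^bsub>M\<^esub> y)"
  using abelian_subgroup.a_rcos_sum[OF submodule_abelian_subgroup]
  by (simp add: quotient_module_def)

lemma quotient_smult: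
  assumes "submodule A R M" and "a \<in> carrier R" and "x \<in> carrier M"
  shows "a \<odot>\<^bsub>quotient_module M A\<^esub> (A +>\<^bsub>M\<^esub> x) = A +>\<^bsub>M\<^esub> (a \<odot>\<^bsub>M\<^esub> x)"
proof -
  have "(\<Union>y\<in>A +>\<^bsub>M\<^esub> x. A +>\<^bsub>M\<^esub> (a \<odot>\<^bsub>M\<^esub> y)) = A +>\<^bsub>M\<^esub> (a \<odot>\<^bsub>M\<^esub> x)"
  proof (rule UN_coset)
    show "A \<noteq> {}"
      using submodule_zero[OF assms(1)] by blast
    fix b assume b: "b \<in> A"
    then have "b \<in> carrier M"
      using submodule_subset[OF assms(1)] by blast
    then show "A +>\<^bsub>M\<^esub> (a \<odot>\<^bsub>M\<^esub> (b \<oplus>\<^bsub>M\<^esub> x)) = A +>\<^bsub>M\<^esub> (a \<odot>\<^bsub>M\<^esub> x)"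
      using assms b by (simp add: smult_r_distr coset_absorb submodule_smult smult_closed)
  qed
  then show ?thesis
    by (simp add: quotient_module_def)
qed

lemma quotient_left_module:
  assumes A: "submodule A R M"
  shows "left_module R (quotient_module M A)"
proof (intro left_module.intro left_module_axioms.intro abelian_groupI R.ring_axioms)
  fix X assume "X \<in> carrier (quotient_module M A)"
  then obtain x where x: "X = A +>\<^bsub>M\<^esub> x" "x \<in> carrier M"
    by (auto simp: quotient_carrier)
  show "\<exists>Y\<in>carrier (quotient_module M A). Y \<oplus>\<^bsub>quotient_module M A\<^esub> X = \<zero>\<^bsub>quotient_module M A\<^esub>"
    by (rule bexI[of _ "A +>\<^bsub>M\<^esub> (\<ominus>\<^bsub>M\<^esub> x)"])
      (use x in \<open>simp_all add: quotient_carrier quotient_add A M.l_neg coset_zero quotient_zero\<close>)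
  show "\<zero>\<^bsub>quotient_module M A\<^esub> \<oplus>\<^bsub>quotient_module M A\<^esub> X = X"
    using quotient_add[OF A M.zero_closed x(2)] x by (simp add: coset_zero[OF A] quotient_zero)
next
  show "\<zero>\<^bsub>quotient_module M A\<^esub> \<in> carrier (quotient_module M A)"
    unfolding quotient_zero quotient_carrier by (rule image_eqI[of _ _ "\<zero>\<^bsub>M\<^esub>"]) (simp_all add: coset_zero A)
qed (auto simp: quotient_carrier quotient_add quotient_smult A smult_closed smult_l_distr
      smult_r_distr smult_assoc1 smult_one M.a_ac)

lemma coset_hom: "submodule A R M \<Longrightarrow> (\<lambda>x. A +>\<^bsub>M\<^esub> x) \<in> module_hom R M (quotient_module M A)"
  by (rule module_homI) (simp_all add: quotient_carrier quotient_add quotient_smult)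

end

text \<open>
  Quotients of a submodule by a smaller one are submodules of the ambient quotient, literally:
  the coset operations only see the addition and the scalar multiplication, not the carrier.
\<close>

lemma quotient_restrict:
  "quotient_module (M\<lparr>carrier := B\<rparr>) A = (quotient_module M A)\<lparr>carrier := (\<lambda>x. A +>\<^bsub>M\<^esub> x) ` B\<rparr>"
  by (simp add: quotient_module_def A_RCOSETS_def' fun_eq_iff set_add_def' a_r_coset_def') auto

locale left_module_hom = M: plain_module R M + N: plain_module R N
  for R :: "('r, 'k) ring_scheme" and M :: "('r, 'm) module" and N :: "('r, 'n) module" +
  fixes f
  assumes hom: "f \<in> module_hom R M N"
begin

lemmas closed = module_hom_closed[OF hom]
lemmas add = module_hom_add[OF hom]
lemmas smult = module_hom_smult[OF hom]

lemma zero: "f \<zero>\<^bsub>M\<^esub> = \<zero>\<^bsub>N\<^esub>"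
proof -
  have "f \<zero>\<^bsub>M\<^esub> \<oplus>\<^bsub>N\<^esub> f \<zero>\<^bsub>M\<^esub> = f \<zero>\<^bsub>M\<^esub>"
    using add[of "\<zero>\<^bsub>M\<^esub>" "\<zero>\<^bsub>M\<^esub>"] by simp
  then show ?thesis
    using closed[of "\<zero>\<^bsub>M\<^esub>"] N.M.add.l_cancel_one by simp
qed

lemma uminus: "x \<in> carrier M \<Longrightarrow> f (\<ominus>\<^bsub>M\<^esub> x) = \<ominus>\<^bsub>N\<^esub> f x"
  using smult[of "\<ominus>\<^bsub>R\<^esub> \<one>\<^bsub>R\<^esub>" x] M.smult_minus_one[of x] N.smult_minus_one[of "f x"] closed by simp

lemma minus: "\<lbrakk>x \<in> carrier M; y \<in> carrier M\<rbrakk> \<Longrightarrow> f (x \<ominus>\<^bsub>M\<^esub> y) = f x \<ominus>\<^bsub>N\<^esub> f y"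
  by (simp add: a_minus_def add uminus)

lemma image_submodule: "submodule A R M \<Longrightarrow> submodule (f ` A) R N"
proof (rule N.submoduleI)
  assume A: "submodule A R M"
  note sub = subsetD[OF M.submodule_subset[OF A]]
  show "f ` A \<subseteq> carrier N"
    using sub closed by blast
  show "\<zero>\<^bsub>N\<^esub> \<in> f ` A"
    using M.submodule_zero[OF A] zero by (metis imageI)
  show "x \<oplus>\<^bsub>N\<^esub> y \<in> f ` A" if xy: "x \<in> f ` A" "y \<in> f ` A" for x y
  proof -
    from xy obtain x' y' where "x' \<in> A" "x = f x'" "y' \<in> A" "y = f y'"
      by blast
    then show ?thesis
      by (intro image_eqI[of _ _ "x' \<oplus>\<^bsub>M\<^esub> y'"]) (simp_all add: add sub M.submodule_add[OF A])
  qed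
  show "a \<odot>\<^bsub>N\<^esub> x \<in> f ` A" if ax: "a \<in> carrier R" "x \<in> f ` A" for a x
  proof -
    from ax obtain x' where "x' \<in> A" "x = f x'"
      by blast
    with ax show ?thesis
      by (intro image_eqI[of _ _ "a \<odot>\<^bsub>M\<^esub> x'"]) (simp_all add: smult sub M.submodule_smult[OF A])
  qed
qed

lemma preimage_submodule: "submodule B R N \<Longrightarrow> submodule {x \<in> carrier M. f x \<in> B} R M"
  by (rule M.submoduleI)
    (auto simp: zero add smult M.smult_closed N.submodule_zero N.submodule_add N.submodule_smult)

lemma kernel_submodule: "submodule (a_kernel M N f) R M"
  by (rule M.submoduleI) (auto simp: a_kernel_def' zero add smult M.smult_closed N.smult_r_zero)

lemma inj_onI:
  assumes "\<And>x. \<lbrakk>x \<in> carrier M; f x = \<zero>\<^bsub>N\<^esub>\<rbrakk> \<Longrightarrow> x = \<zero>\<^bsub>M\<^esub>"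
  shows "inj_on f (carrier M)"
proof (rule Fun.inj_onI)
  fix x y assume xy: "x \<in> carrier M" "y \<in> carrier M" "f x = f y"
  then have "f (x \<ominus>\<^bsub>M\<^esub> y) = \<zero>\<^bsub>N\<^esub>"
    using closed unfolding minus[OF xy(1,2)] by (simp add: N.minus_eq_zero_iff)
  then show "x = y"
    using assms[of "x \<ominus>\<^bsub>M\<^esub> y"] xy M.minus_eq_zero_iff by simp
qed

lemma induced_map_coset:
  assumes A: "submodule A R M" and B: "submodule B R N" and sub: "f ` A \<subseteq> B" and x: "x \<in> carrier M"
  shows "induced_map N B f (A +>\<^bsub>M\<^esub> x) = B +>\<^bsub>N\<^esub> f x"
  unfolding induced_map_def
proof (rule UN_coset)
  show "A \<noteq> {}"
    using M.submodule_zero[OF A] by blast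
  fix a assume a: "a \<in> A"
  then have "a \<in> carrier M" "f a \<in> B"
    using M.submodule_subset[OF A] sub by auto
  then show "B +>\<^bsub>N\<^esub> f (a \<oplus>\<^bsub>M\<^esub> x) = B +>\<^bsub>N\<^esub> f x"
    using x by (simp add: add N.coset_absorb[OF B] closed)
qed

lemma induced_map_hom:
  assumes A: "submodule A R M" and B: "submodule B R N" and sub: "f ` A \<subseteq> B"
  shows "induced_map N B f \<in> module_hom R (quotient_module M A) (quotient_module N B)"
  by (rule module_homI)
    (auto simp: quotient_carrier induced_map_coset[OF assms] M.quotient_add[OF A] N.quotient_add[OF B]
      M.quotient_smult[OF A] N.quotient_smult[OF B] closed add smult M.smult_closed)

text \<open>
  All isomorphisms of quotients below are of this form: \<open>M/A \<rightarrow> N/B\<close> is injective because \<open>A\<close> is the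
  whole preimage of \<open>B\<close>, and surjective because \<open>N = f(M) + B\<close>.
\<close>

lemma induced_map_iso:
  assumes A: "submodule A R M" and B: "submodule B R N"
    and preimage: "\<And>x. x \<in> carrier M \<Longrightarrow> f x \<in> B \<longleftrightarrow> x \<in> A"
    and cover: "\<And>y. y \<in> carrier N \<Longrightarrow> \<exists>x\<in>carrier M. \<exists>b\<in>B. y = b \<oplus>\<^bsub>N\<^esub> f x"
  shows "induced_map N B f \<in> module_iso R (quotient_module M A) (quotient_module N B)"
proof (rule module_isoI)
  have sub: "f ` A \<subseteq> B"
    using preimage M.submodule_subset[OF A] by auto
  note coset = induced_map_coset[OF A B sub]
  show hom: "induced_map N B f \<in> module_hom R (quotient_module M A) (quotient_module N B)"
    by (rule induced_map_hom[OF A B sub])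
  show "inj_on (induced_map N B f) (carrier (quotient_module M A))"
  proof (rule left_module_hom.inj_onI)
    show "left_module_hom R (quotient_module M A) (quotient_module N B) (induced_map N B f)"
      by (intro left_module_hom.intro left_module_hom_axioms.intro plain_module.intro
          M.quotient_left_module N.quotient_left_module A B hom)
    fix X assume X: "X \<in> carrier (quotient_module M A)" "induced_map N B f X = \<zero>\<^bsub>quotient_module N B\<^esub>"
    then obtain x where x: "x \<in> carrier M" "X = A +>\<^bsub>M\<^esub> x"
      by (auto simp: quotient_carrier)
    with X(2) have "x \<in> A"
      by (simp add: quotient_zero coset N.coset_zero_iff[OF B] closed preimage)
    with x show "X = \<zero>\<^bsub>quotient_module M A\<^esub>"
      by (simp add: quotient_zero M.coset_zero_iff[OF A])
  qed
  show "\<exists>X\<in>carrier (quotient_module M A). Y = induced_map N B f X"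
    if "Y \<in> carrier (quotient_module N B)" for Y
  proof -
    from that obtain y where y: "y \<in> carrier N" "Y = B +>\<^bsub>N\<^esub> y"
      by (auto simp: quotient_carrier)
    from cover[OF y(1)] obtain x b where "x \<in> carrier M" "b \<in> B" "y = b \<oplus>\<^bsub>N\<^esub> f x"
      by blast
    with y have "Y = induced_map N B f (A +>\<^bsub>M\<^esub> x)" "A +>\<^bsub>M\<^esub> x \<in> carrier (quotient_module M A)"
      by (auto simp: coset N.coset_absorb[OF B] closed quotient_carrier)
    then show ?thesis
      by blast
  qed
qed

end

lemma left_module_homI:
  "\<lbrakk>left_module R M; left_module R N; f \<in> module_hom R M N\<rbrakk> \<Longrightarrow> left_module_hom R M N f"
  by (simp add: left_module_hom.intro plain_module.intro left_module_hom_axioms.intro)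

section \<open>Finite length is invariant under isomorphism\<close>

lemma simple_module_iso:
  assumes M: "simple_module R M" and N: "left_module R N" and f: "f \<in> module_iso R M N"
  shows "simple_module R N"
proof -
  interpret left_module_hom R M N f
    using M N module_iso_hom[OF f] by (intro left_module_homI) (simp_all add: simple_module_def)
  have inj: "inj_on f (carrier M)" and surj: "f ` carrier M = carrier N"
    using module_iso_bij[OF f] by (auto simp: bij_betw_def)
  have "carrier N \<noteq> {\<zero>\<^bsub>N\<^esub>}"
  proof
    assume trivial: "carrier N = {\<zero>\<^bsub>N\<^esub>}"
    have "x = \<zero>\<^bsub>M\<^esub>" if x: "x \<in> carrier M" for x
    proof (rule inj_onD[OF inj _ x M.M.zero_closed])
      show "f x = f \<zero>\<^bsub>M\<^esub>"
        using closed[OF x] unfolding trivial zero by simp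
    qed
    then have "carrier M = {\<zero>\<^bsub>M\<^esub>}"
      using M.M.zero_closed by blast
    then show False
      using M by (simp add: simple_module_def)
  qed
  moreover have "B = {\<zero>\<^bsub>N\<^esub>} \<or> B = carrier N" if B: "submodule B R N" for B
  proof -
    have "B \<subseteq> f ` carrier M"
      unfolding surj by (rule N.submodule_subset[OF B])
    then have image: "f ` {x \<in> carrier M. f x \<in> B} = B"
      by blast
    have "{x \<in> carrier M. f x \<in> B} = {\<zero>\<^bsub>M\<^esub>} \<or> {x \<in> carrier M. f x \<in> B} = carrier M"
      using M preimage_submodule[OF B] by (simp add: simple_module_def)
    then have "f ` {x \<in> carrier M. f x \<in> B} = {\<zero>\<^bsub>N\<^esub>} \<or> f ` {x \<in> carrier M. f x \<in> B} = carrier N"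
      using surj zero by (elim disjE) simp_all
    then show ?thesis
      unfolding image .
  qed
  ultimately show ?thesis
    using N by (simp add: simple_module_def)
qed

text \<open>
  The images of the terms of a composition series form a composition series, since the isomorphism
  induces isomorphisms between the factors.
\<close>

lemma finite_length_iso:
  assumes M: "finite_length R M" and N: "left_module R N" and f: "f \<in> module_iso R M N"
  shows "finite_length R N"
proof -
  interpret left_module_hom R M N f
    using M N module_iso_hom[OF f] by (intro left_module_homI) (simp_all add: finite_length_def)
  have inj: "inj_on f (carrier M)" and surj: "f ` carrier M = carrier N"
    using module_iso_bij[OF f] by (auto simp: bij_betw_def)
  from M obtain n S where S: "S 0 = {\<zero>\<^bsub>M\<^esub>} \<and> S n = carrier M \<and> (\<forall>i\<le>n. submodule (S i) R M) \<and>
      (\<forall>i<n. S i \<subseteq> S (Suc i) \<and> simple_module R (quotient_module (M\<lparr>carrier := S (Suc i)\<rparr>) (S i)))"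
    unfolding finite_length_def by (elim conjE exE) (rule that, intro conjI)
  have submod: "submodule (S i) R M" if "i \<le> n" for i
    using S that by simp
  have incl: "S i \<subseteq> S (Suc i)"
    and simple: "simple_module R (quotient_module (M\<lparr>carrier := S (Suc i)\<rparr>) (S i))" if "i < n" for i
    using S that by simp_all
  have "simple_module R (quotient_module (N\<lparr>carrier := f ` S (Suc i)\<rparr>) (f ` S i))" if i: "i < n" for i
  proof -
    let ?M = "M\<lparr>carrier := S (Suc i)\<rparr>" and ?N = "N\<lparr>carrier := f ` S (Suc i)\<rparr>"
    have sub: "submodule (S i) R M" "submodule (S (Suc i)) R M"
      using submod i by auto
    note sub' = sub[THEN image_submodule]
    have subset: "S (Suc i) \<subseteq> carrier M"
      by (rule M.submodule_subset[OF sub(2)])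
    interpret step: left_module_hom R ?M ?N f
      by (intro left_module_homI M.submodule_left_module N.submodule_left_module
          module_hom_restrict[OF hom] sub sub' subset order_refl)
    have A: "submodule (S i) R ?M"
      by (rule M.submodule_restrict[OF sub incl[OF i]])
    have B: "submodule (f ` S i) R ?N"
      by (rule N.submodule_restrict[OF sub' image_mono[OF incl[OF i]]])
    have "induced_map ?N (f ` S i) f \<in> module_iso R (quotient_module ?M (S i)) (quotient_module ?N (f ` S i))"
    proof (rule step.induced_map_iso[OF A B])
      show "f x \<in> f ` S i \<longleftrightarrow> x \<in> S i" if "x \<in> carrier ?M" for x
        using that subset M.submodule_subset[OF sub(1)]
        by (intro inj_on_image_mem_iff[OF inj]) auto
      fix y assume "y \<in> carrier ?N"
      then obtain x where x: "x \<in> S (Suc i)" "y = f x"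
        by auto
      then have "y = \<zero>\<^bsub>N\<^esub> \<oplus>\<^bsub>?N\<^esub> f x"
        using closed subset by auto
      with x(1) show "\<exists>x\<in>carrier ?M. \<exists>b\<in>f ` S i. y = b \<oplus>\<^bsub>?N\<^esub> f x"
        by (intro bexI[of _ x] bexI[of _ "\<zero>\<^bsub>N\<^esub>"]) (simp_all add: N.submodule_zero[OF sub'(1)])
    qed
    then show ?thesis
      by (rule simple_module_iso[OF simple[OF i] step.N.quotient_left_module[OF B]])
  qed
  note simple' = this
  show ?thesis
    unfolding finite_length_def
  proof (intro conjI exI[of _ n] exI[of _ "\<lambda>i. f ` S i"] allI impI)
    show "f ` S 0 = {\<zero>\<^bsub>N\<^esub>}" "f ` S n = carrier N"
      using S zero surj by simp_all
  qed (use N simple' in \<open>auto intro!: image_submodule submod image_mono incl\<close>)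
qed

section \<open>Pushouts\<close>

definition direct_sum :: "('r, 'm) module \<Rightarrow> ('r, 'n) module \<Rightarrow> ('r, 'm \<times> 'n) module" where
  "direct_sum M N =
     \<lparr>carrier = carrier M \<times> carrier N,
      mult = undefined,
      one = undefined,
      zero = (\<zero>\<^bsub>M\<^esub>, \<zero>\<^bsub>N\<^esub>),
      add = (\<lambda>(x, y) (x', y'). (x \<oplus>\<^bsub>M\<^esub> x', y \<oplus>\<^bsub>N\<^esub> y')),
      smult = (\<lambda>a (x, y). (a \<odot>\<^bsub>M\<^esub> x, a \<odot>\<^bsub>N\<^esub> y))\<rparr>"

lemma direct_sum_simps:
  "carrier (direct_sum M N) = carrier M \<times> carrier N"
  "\<zero>\<^bsub>direct_sum M N\<^esub> = (\<zero>\<^bsub>M\<^esub>, \<zero>\<^bsub>N\<^esub>)"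
  "(x, y) \<oplus>\<^bsub>direct_sum M N\<^esub> (x', y') = (x \<oplus>\<^bsub>M\<^esub> x', y \<oplus>\<^bsub>N\<^esub> y')"
  "a \<odot>\<^bsub>direct_sum M N\<^esub> (x, y) = (a \<odot>\<^bsub>M\<^esub> x, a \<odot>\<^bsub>N\<^esub> y)"
  by (simp_all add: direct_sum_def)

lemma direct_sum_left_module:
  assumes "left_module R M" and "left_module R N"
  shows "left_module R (direct_sum M N)"
proof -
  interpret M: left_module R M by fact
  interpret N: left_module R N by fact
  show ?thesis
  proof (intro left_module.intro left_module_axioms.intro abelian_groupI M.R.ring_axioms)
    fix z assume "z \<in> carrier (direct_sum M N)"
    then obtain x y where "z = (x, y)" "x \<in> carrier M" "y \<in> carrier N"
      by (auto simp: direct_sum_simps)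
    then show "\<exists>z'\<in>carrier (direct_sum M N). z' \<oplus>\<^bsub>direct_sum M N\<^esub> z = \<zero>\<^bsub>direct_sum M N\<^esub>"
      by (intro bexI[of _ "(\<ominus>\<^bsub>M\<^esub> x, \<ominus>\<^bsub>N\<^esub> y)"]) (simp_all add: direct_sum_simps M.M.l_neg N.M.l_neg)
  qed (auto simp: direct_sum_simps M.M.a_ac N.M.a_ac M.smult_closed N.smult_closed M.smult_l_distr
      N.smult_l_distr M.smult_r_distr N.smult_r_distr M.smult_assoc1 N.smult_assoc1 M.smult_one N.smult_one)
qed

lemma direct_sum_pair_hom:
  "\<lbrakk>f \<in> module_hom R L M; g \<in> module_hom R L N\<rbrakk> \<Longrightarrow> (\<lambda>x. (f x, g x)) \<in> module_hom R L (direct_sum M N)"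
  by (rule module_homI) (simp_all add: direct_sum_simps module_hom_closed module_hom_add module_hom_smult)

lemma module_hom_id: "(\<lambda>x. x) \<in> module_hom R M M"
  by (simp add: module_hom_def)

lemma module_hom_zero: "left_module R N \<Longrightarrow> (\<lambda>x. \<zero>\<^bsub>N\<^esub>) \<in> module_hom R M N"
proof -
  assume "left_module R N"
  then interpret N: left_module R N .
  show ?thesis
    by (rule module_homI) (simp_all add: N.smult_r_zero)
qed

lemma (in left_module_hom) uminus_hom: "(\<lambda>x. \<ominus>\<^bsub>N\<^esub> f x) \<in> module_hom R M N"
  by (rule module_homI) (simp_all add: closed add smult N.smult_uminus N.M.minus_add)

lemma pushout_universal:
  fixes B :: "('r, 'm) module" and T :: "('r, ('m \<times> 'm) set) module"
  assumes "is_pushout R A B C D f g h k" and "left_module R T"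
    and "b \<in> module_hom R B T" and "c \<in> module_hom R C T" and "\<forall>a\<in>carrier A. b (f a) = c (g a)"
  shows "\<exists>d\<in>module_hom R D T. (\<forall>y\<in>carrier B. d (h y) = b y) \<and> (\<forall>z\<in>carrier C. d (k z) = c z) \<and>
    (\<forall>d'\<in>module_hom R D T. (\<forall>y\<in>carrier B. d' (h y) = b y) \<and> (\<forall>z\<in>carrier C. d' (k z) = c z) \<longrightarrow>
      (\<forall>x\<in>carrier D. d' x = d x))"
  using assms(1)[unfolded is_pushout_def, THEN conjunct2, THEN spec[of _ T], THEN spec[of _ b],
      THEN spec[of _ c]] assms(2-) by simp

lemma pushout_factor:
  fixes B :: "('r, 'm) module" and T :: "('r, ('m \<times> 'm) set) module"
  assumes "is_pushout R A B C D f g h k" and "left_module R T"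
    and "b \<in> module_hom R B T" and "c \<in> module_hom R C T" and "\<forall>a\<in>carrier A. b (f a) = c (g a)"
  obtains d where "\<forall>y\<in>carrier B. d (h y) = b y" and "\<forall>z\<in>carrier C. d (k z) = c z"
  using pushout_universal[OF assms] by (elim bexE conjE)

lemma pushout_unique:
  fixes B :: "('r, 'm) module" and T :: "('r, ('m \<times> 'm) set) module"
  assumes "is_pushout R A B C D f g h k" and "left_module R T"
    and "b \<in> module_hom R B T" and "c \<in> module_hom R C T" and "\<forall>a\<in>carrier A. b (f a) = c (g a)"
    and d: "d \<in> module_hom R D T" "\<forall>y\<in>carrier B. d (h y) = b y" "\<forall>z\<in>carrier C. d (k z) = c z"
    and d': "d' \<in> module_hom R D T" "\<forall>y\<in>carrier B. d' (h y) = b y" "\<forall>z\<in>carrier C. d' (k z) = c z"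
    and x: "x \<in> carrier D"
  shows "d x = d' x"
proof -
  from pushout_universal[OF assms(1-5)] obtain e where
    e: "\<forall>d\<in>module_hom R D T. (\<forall>y\<in>carrier B. d (h y) = b y) \<and> (\<forall>z\<in>carrier C. d (k z) = c z) \<longrightarrow>
      (\<forall>x\<in>carrier D. d x = e x)"
    by (elim bexE conjE)
  have "d x = e x"
    using e[THEN bspec, OF d(1)] d x by simp
  moreover have "d' x = e x"
    using e[THEN bspec, OF d'(1)] d' x by simp
  ultimately show ?thesis
    by simp
qed

text \<open>
  The test module is \<open>D/(h(B) + k(C))\<close>, realised as \<open>(D \<oplus> D)/((h(B) + k(C)) \<oplus> D)\<close> so that its
  elements have the type that the universal property speaks of: the projection and the zero map
  agree on \<open>B\<close> and \<open>C\<close>.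
\<close>

lemma pushout_cover:
  fixes R :: "('r, 'k) ring_scheme" and B :: "('r, 'm) module"
  assumes pushout: "is_pushout R A B C D f g h k"
    and "left_module R B" and "left_module R C" and "left_module R D"
    and h: "h \<in> module_hom R B D" and k: "k \<in> module_hom R C D"
    and x: "x \<in> carrier D"
  shows "\<exists>y\<in>carrier B. \<exists>z\<in>carrier C. x = h y \<oplus>\<^bsub>D\<^esub> k z"
proof -
  interpret h: left_module_hom R B D h
    by (intro left_module_homI assms)
  interpret k: left_module_hom R C D k
    by (intro left_module_homI assms)
  let ?s = "\<lambda>(y, z). h y \<oplus>\<^bsub>D\<^esub> k z"
  interpret s: left_module_hom R "direct_sum B C" D ?s
  proof (intro left_module_homI direct_sum_left_module assms module_homI)
    fix u v assume "u \<in> carrier (direct_sum B C)" "v \<in> carrier (direct_sum B C)"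
    then obtain y z y' z' where "u = (y, z)" "v = (y', z')" "y \<in> carrier B" "z \<in> carrier C"
      "y' \<in> carrier B" "z' \<in> carrier C"
      by (auto simp: direct_sum_simps)
    then show "?s (u \<oplus>\<^bsub>direct_sum B C\<^esub> v) = ?s u \<oplus>\<^bsub>D\<^esub> ?s v"
      by (simp add: direct_sum_simps h.add k.add h.closed k.closed h.N.M.a_ac)
  qed (auto simp: direct_sum_simps h.smult k.smult h.closed k.closed h.N.smult_r_distr)
  define E where "E = ?s ` carrier (direct_sum B C)"
  have E: "submodule E R D"
    unfolding E_def by (rule s.image_submodule[OF s.M.submodule_carrier])
  have E_I: "h y \<oplus>\<^bsub>D\<^esub> k z \<in> E" if "y \<in> carrier B" "z \<in> carrier C" for y z
    unfolding E_def using that by (intro image_eqI[of _ _ "(y, z)"]) (simp_all add: direct_sum_simps)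
  have h_E: "h y \<in> E" if "y \<in> carrier B" for y
    using E_I[OF that k.M.M.zero_closed] that by (simp add: k.zero h.closed)
  have k_E: "k z \<in> E" if "z \<in> carrier C" for z
    using E_I[OF h.M.M.zero_closed that] that by (simp add: h.zero k.closed)
  interpret S: plain_module R "direct_sum D D"
    by (intro plain_module.intro direct_sum_left_module assms)
  define N where "N = E \<times> carrier D"
  have N: "submodule N R (direct_sum D D)"
    unfolding N_def
    using h.N.submodule_subset[OF E] h.N.submodule_zero[OF E] h.N.submodule_add[OF E]
      h.N.submodule_smult[OF E]
    by (intro S.submoduleI) (auto simp: direct_sum_simps h.N.smult_closed)
  define T where "T = quotient_module (direct_sum D D) N"
  have T: "left_module R T"
    unfolding T_def by (rule S.quotient_left_module[OF N])
  define q where "q = (\<lambda>x. N +>\<^bsub>direct_sum D D\<^esub> (x, \<zero>\<^bsub>D\<^esub>))"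
  have q: "q \<in> module_hom R D T"
    unfolding q_def T_def
    using module_hom_comp[OF direct_sum_pair_hom[OF module_hom_id module_hom_zero[OF assms(4)]]
        S.coset_hom[OF N]] by (simp add: comp_def)
  have q_zero: "q x = \<zero>\<^bsub>T\<^esub> \<longleftrightarrow> x \<in> E" if "x \<in> carrier D" for x
    using S.coset_zero_iff[OF N, of "(x, \<zero>\<^bsub>D\<^esub>)"] that
    by (simp add: q_def T_def N_def quotient_zero direct_sum_simps)
  note zero = module_hom_zero[OF T]
  have "q x = \<zero>\<^bsub>T\<^esub>"
    by (rule pushout_unique[OF pushout T zero zero _ q _ _ zero _ _ x])
      (simp_all add: q_zero h_E k_E h.closed k.closed)
  then have "x \<in> E"
    using q_zero x by simp
  then show ?thesis
    by (auto simp: E_def direct_sum_simps)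
qed

text \<open>
  The test module is the standard pushout \<open>(B \<oplus> C)/{(f a, - g a) | a \<in> A}\<close>. The maps from \<open>B\<close> and \<open>C\<close>
  to it factor through \<open>D\<close>, so \<open>h y = k z\<close> makes \<open>(y, - z)\<close> one of the relations.
\<close>

lemma pushout_exact:
  fixes R :: "('r, 'k) ring_scheme" and A B C D :: "('r, 'm) module"
  assumes pushout: "is_pushout R A B C D f g h k"
    and "left_module R A" and "left_module R B" and "left_module R C"
    and f: "f \<in> module_hom R A B" and g: "g \<in> module_hom R A C"
    and y: "y \<in> carrier B" and z: "z \<in> carrier C" and eq: "h y = k z"
  shows "\<exists>a\<in>carrier A. y = f a \<and> z = g a"
proof -
  interpret f: left_module_hom R A B f
    by (intro left_module_homI assms)
  interpret g: left_module_hom R A C g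
    by (intro left_module_homI assms)
  let ?S = "direct_sum B C"
  interpret S: plain_module R ?S
    by (intro plain_module.intro direct_sum_left_module f.N.left_module_axioms g.N.left_module_axioms)
  let ?r = "\<lambda>a. (f a, \<ominus>\<^bsub>C\<^esub> g a)"
  interpret r: left_module_hom R A ?S ?r
    by (intro left_module_homI direct_sum_pair_hom f g.uminus_hom
        f.M.left_module_axioms S.left_module_axioms)
  define N where "N = ?r ` carrier A"
  have N: "submodule N R ?S"
    unfolding N_def by (rule r.image_submodule[OF f.M.submodule_carrier])
  let ?T = "quotient_module ?S N"
  let ?b = "\<lambda>y. N +>\<^bsub>?S\<^esub> (y, \<zero>\<^bsub>C\<^esub>)" and ?c = "\<lambda>z. N +>\<^bsub>?S\<^esub> (\<zero>\<^bsub>B\<^esub>, z)"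
  have b: "?b \<in> module_hom R B ?T"
    using module_hom_comp[OF direct_sum_pair_hom[OF module_hom_id module_hom_zero[OF g.N.left_module_axioms]]
        S.coset_hom[OF N]] by (simp add: comp_def)
  have c: "?c \<in> module_hom R C ?T"
    using module_hom_comp[OF direct_sum_pair_hom[OF module_hom_zero[OF f.N.left_module_axioms] module_hom_id]
        S.coset_hom[OF N]] by (simp add: comp_def)
  have bc: "?b y = ?c z \<longleftrightarrow> (y, \<ominus>\<^bsub>C\<^esub> z) \<in> N" if "y \<in> carrier B" "z \<in> carrier C" for y z
  proof -
    have "\<ominus>\<^bsub>?S\<^esub> (\<zero>\<^bsub>B\<^esub>, z) = (\<zero>\<^bsub>B\<^esub>, \<ominus>\<^bsub>C\<^esub> z)"
      by (rule S.M.minus_equality) (use that in \<open>simp_all add: direct_sum_simps g.N.M.l_neg\<close>)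
    then have "(y, \<zero>\<^bsub>C\<^esub>) \<ominus>\<^bsub>?S\<^esub> (\<zero>\<^bsub>B\<^esub>, z) = (y, \<ominus>\<^bsub>C\<^esub> z)"
      using that by (simp add: a_minus_def direct_sum_simps)
    then show ?thesis
      using S.coset_eq_iff[OF N, of "(y, \<zero>\<^bsub>C\<^esub>)" "(\<zero>\<^bsub>B\<^esub>, z)"] that by (simp add: direct_sum_simps)
  qed
  have compatible: "\<forall>a\<in>carrier A. ?b (f a) = ?c (g a)"
    by (intro ballI, subst bc) (auto simp: N_def f.closed g.closed)
  obtain d where "\<forall>y\<in>carrier B. d (h y) = ?b y" "\<forall>z\<in>carrier C. d (k z) = ?c z"
    by (rule pushout_factor[OF pushout S.quotient_left_module[OF N] b c compatible])
  from this(1)[THEN bspec, OF y] this(2)[THEN bspec, OF z] have "?b y = ?c z"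
    unfolding eq by simp
  then obtain a where "a \<in> carrier A" "y = f a" "\<ominus>\<^bsub>C\<^esub> z = \<ominus>\<^bsub>C\<^esub> g a"
    using bc[OF y z] by (auto simp: N_def)
  then show ?thesis
    using z g.closed g.N.M.minus_minus by metis
qed

section \<open>The direct limit of a sequence of modules\<close>

locale module_sequence = ring R for R :: "('r, 'k) ring_scheme" (structure) +
  fixes U :: "nat \<Rightarrow> ('r, 'm) module" and w :: "nat \<Rightarrow> 'm \<Rightarrow> 'm"
  assumes left_module: "left_module R (U i)"
    and w_hom: "w i \<in> module_hom R (U i) (U (Suc i))"
begin

abbreviation limit where "limit \<equiv> limit_module U w"
abbreviation to_limit where "to_limit \<equiv> limit_map U w"

sublocale U: plain_module R "U i" for i
  by (rule plain_module.intro[OF left_module])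

sublocale w: left_module_hom R "U i" "U (Suc i)" "w i" for i
  by (intro left_module_homI left_module w_hom)

lemma seq_map_add: "seq_map w i (m + n) x = seq_map w (i + m) n (seq_map w i m x)"
  by (induction n) (simp_all add: add.assoc)

lemma seq_map_hom: "seq_map w i n \<in> module_hom R (U i) (U (i + n))"
proof (induction n)
  case 0
  show ?case
    by (simp add: module_hom_def)
next
  case (Suc n)
  then show ?case
    using module_hom_comp[OF Suc w_hom] by (simp add: comp_def fun_eq_iff module_hom_def)
qed

sublocale seq: left_module_hom R "U i" "U (i + n)" "seq_map w i n" for i n
  by (intro left_module_homI left_module seq_map_hom)

lemma seq_map_extend:
  "\<lbrakk>i + m = j + n; seq_map w i m x = seq_map w j n y\<rbrakk> \<Longrightarrow>
    seq_map w i (m + p) x = seq_map w j (n + p) y"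
  by (simp add: seq_map_add)

lemma to_limit_eq_iff:
  assumes y: "y \<in> carrier (U j)"
  shows "to_limit i x = to_limit j y \<longleftrightarrow>
    (\<exists>m n. i + m = j + n \<and> seq_map w i m x = seq_map w j n y)" (is "_ \<longleftrightarrow> ?agree")
proof
  assume "to_limit i x = to_limit j y"
  moreover have "(j, y) \<in> to_limit j y"
    using y by (auto simp: limit_map_def)
  ultimately have "(j, y) \<in> to_limit i x"
    by simp
  then show ?agree
    by (simp add: limit_map_def)
next
  assume ?agree
  then obtain m n where mn: "i + m = j + n" "seq_map w i m x = seq_map w j n y"
    by blast
  have "(\<exists>m n. i + m = k + n \<and> seq_map w i m x = seq_map w k n z) \<longleftrightarrow>
        (\<exists>m n. j + m = k + n \<and> seq_map w j m y = seq_map w k n z)" for k z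
  proof (intro iffI; elim exE conjE)
    fix p q assume pq: "i + p = k + q" "seq_map w i p x = seq_map w k q z"
    have "seq_map w j (n + p) y = seq_map w k (q + m) z"
      using seq_map_extend[OF mn, of p] seq_map_extend[OF pq, of m] by (simp add: add.commute)
    moreover have "j + (n + p) = k + (q + m)"
      using mn(1) pq(1) by simp
    ultimately show "\<exists>m n. j + m = k + n \<and> seq_map w j m y = seq_map w k n z"
      by blast
  next
    fix p q assume pq: "j + p = k + q" "seq_map w j p y = seq_map w k q z"
    have "seq_map w i (m + p) x = seq_map w k (q + n) z"
      using seq_map_extend[OF mn, of p] seq_map_extend[OF pq, of n] by (simp add: add.commute)
    moreover have "i + (m + p) = k + (q + n)"
      using mn(1) pq(1) by simp
    ultimately show "\<exists>m n. i + m = k + n \<and> seq_map w i m x = seq_map w k n z"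
      by blast
  qed
  then show "to_limit i x = to_limit j y"
    by (simp add: limit_map_def)
qed

lemma to_limit_self: "x \<in> carrier (U i) \<Longrightarrow> (i, x) \<in> to_limit i x"
  by (auto simp: limit_map_def)

lemma to_limit_mem:
  "(j, y) \<in> to_limit i x \<Longrightarrow>
    y \<in> carrier (U j) \<and> (\<exists>m n. i + m = j + n \<and> seq_map w i m x = seq_map w j n y)"
  by (simp add: limit_map_def)

lemma to_limit_seq: "x \<in> carrier (U i) \<Longrightarrow> to_limit (i + n) (seq_map w i n x) = to_limit i x"
  by (subst to_limit_eq_iff, assumption, rule exI[of _ 0], rule exI[of _ n]) simp

lemma to_limit_w: "x \<in> carrier (U i) \<Longrightarrow> to_limit (Suc i) (w i x) = to_limit i x"
  using to_limit_seq[of x i 1] by simp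

lemma to_limit_inj:
  assumes w_inj: "\<And>i. inj_on (w i) (carrier (U i))"
  shows "inj_on (to_limit i) (carrier (U i))"
proof (rule inj_onI)
  have inj: "seq_map w i n x = seq_map w i n y \<Longrightarrow> x = y"
    if "x \<in> carrier (U i)" "y \<in> carrier (U i)" for n x y
    using that
    by (induction n) (use inj_onD[OF w_inj] seq.closed in auto)
  show "x = y" if "x \<in> carrier (U i)" "y \<in> carrier (U i)" "to_limit i x = to_limit i y" for x y
    using that inj by (auto simp: to_limit_eq_iff)
qed

lemma limit_carrier: "carrier limit = (\<Union>i. limit_part U w i)"
  by (simp add: limit_module_def limit_part_def)

lemma to_limit_closed: "x \<in> carrier (U i) \<Longrightarrow> to_limit i x \<in> carrier limit"
  by (auto simp: limit_carrier limit_part_def)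

lemma limit_part_mono:
  assumes "i \<le> j"
  shows "limit_part U w i \<subseteq> limit_part U w j"
proof -
  from assms obtain n where "j = i + n"
    by (auto simp: le_iff_add)
  moreover have "to_limit i x \<in> limit_part U w (i + n)" if "x \<in> carrier (U i)" for x
    unfolding limit_part_def to_limit_seq[OF that, of n, symmetric]
    by (rule imageI) (rule seq.closed[OF that])
  ultimately show ?thesis
    by (auto simp: limit_part_def)
qed

lemma limit_common_part:
  assumes "X \<in> carrier limit" and "Y \<in> carrier limit" and "Z \<in> carrier limit"
  obtains i x y z where "x \<in> carrier (U i)" "X = to_limit i x" "y \<in> carrier (U i)" "Y = to_limit i y"
    and "z \<in> carrier (U i)" "Z = to_limit i z"
proof -
  from assms obtain i j k where "X \<in> limit_part U w i" "Y \<in> limit_part U w j" "Z \<in> limit_part U w k"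
    by (auto simp: limit_carrier)
  moreover define l where "l = i + j + k"
  ultimately have "X \<in> limit_part U w l" "Y \<in> limit_part U w l" "Z \<in> limit_part U w l"
    using limit_part_mono[of i l] limit_part_mono[of j l] limit_part_mono[of k l] by auto
  then show thesis
    using that[of _ l] by (auto simp: limit_part_def)
qed

lemma limit_zero: "\<zero>\<^bsub>limit\<^esub> = to_limit i \<zero>\<^bsub>U i\<^esub>"
  using to_limit_seq[of "\<zero>\<^bsub>U 0\<^esub>" 0 i] seq.zero[of 0 i] by (simp add: limit_module_def)

text \<open>
  The addition of the limit is defined as a union over all pairs of representatives at a common
  index. It is the expected class because all these pairs contribute the same class.
\<close>

lemma limit_add:
  assumes x: "x \<in> carrier (U i)" and y: "y \<in> carrier (U i)"
  shows "to_limit i x \<oplus>\<^bsub>limit\<^esub> to_limit i y = to_limit i (x \<oplus>\<^bsub>U i\<^esub> y)"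
proof -
  have eq: "to_limit k (x' \<oplus>\<^bsub>U k\<^esub> y') = to_limit i (x \<oplus>\<^bsub>U i\<^esub> y)"
    if x': "(k, x') \<in> to_limit i x" and y': "(k, y') \<in> to_limit i y" for k x' y'
  proof -
    from to_limit_mem[OF x'] obtain m n where mn: "i + m = k + n" "seq_map w i m x = seq_map w k n x'"
      and x'_in: "x' \<in> carrier (U k)" by blast
    from to_limit_mem[OF y'] obtain p q where pq: "i + p = k + q" "seq_map w i p y = seq_map w k q y'"
      and y'_in: "y' \<in> carrier (U k)" by blast
    \<comment> \<open>Both agreements hold at the common stage \<open>i + m + p\<close>.\<close>
    have x_eq: "seq_map w i (m + p) x = seq_map w k (n + p) x'"
      by (rule seq_map_extend[OF mn])
    have "n + p = q + m"
      using mn(1) pq(1) by simp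
    then have y_eq: "seq_map w i (m + p) y = seq_map w k (n + p) y'"
      using seq_map_extend[OF pq, of m] by (simp add: add.commute[of m p])
    have stage: "i + (m + p) = k + (n + p)"
      using mn(1) by simp
    have "seq_map w i (m + p) (x \<oplus>\<^bsub>U i\<^esub> y) = seq_map w k (n + p) (x' \<oplus>\<^bsub>U k\<^esub> y')"
      unfolding seq.add[OF x y] seq.add[OF x'_in y'_in] x_eq y_eq stage ..
    with stage have "\<exists>m n. i + m = k + n \<and>
        seq_map w i m (x \<oplus>\<^bsub>U i\<^esub> y) = seq_map w k n (x' \<oplus>\<^bsub>U k\<^esub> y')"
      by blast
    then have "to_limit i (x \<oplus>\<^bsub>U i\<^esub> y) = to_limit k (x' \<oplus>\<^bsub>U k\<^esub> y')"
      using x'_in y'_in by (simp add: to_limit_eq_iff)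
    then show ?thesis
      by simp
  qed
  have "{to_limit k (x' \<oplus>\<^bsub>U k\<^esub> y') | k x' y'. (k, x') \<in> to_limit i x \<and> (k, y') \<in> to_limit i y} =
    {to_limit i (x \<oplus>\<^bsub>U i\<^esub> y)}" (is "?S = _")
  proof (rule subset_antisym)
    show "?S \<subseteq> {to_limit i (x \<oplus>\<^bsub>U i\<^esub> y)}"
      using eq by blast
    show "{to_limit i (x \<oplus>\<^bsub>U i\<^esub> y)} \<subseteq> ?S"
      using to_limit_self[OF x] to_limit_self[OF y] by blast
  qed
  then show ?thesis
    by (simp add: limit_module_def)
qed

lemma limit_smult:
  assumes a: "a \<in> carrier R" and x: "x \<in> carrier (U i)"
  shows "a \<odot>\<^bsub>limit\<^esub> to_limit i x = to_limit i (a \<odot>\<^bsub>U i\<^esub> x)"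
proof -
  have eq: "to_limit k (a \<odot>\<^bsub>U k\<^esub> x') = to_limit i (a \<odot>\<^bsub>U i\<^esub> x)" if x': "(k, x') \<in> to_limit i x" for k x'
  proof -
    from to_limit_mem[OF x'] obtain m n where mn: "i + m = k + n" "seq_map w i m x = seq_map w k n x'"
      and x'_in: "x' \<in> carrier (U k)" by blast
    then have "seq_map w i m (a \<odot>\<^bsub>U i\<^esub> x) = seq_map w k n (a \<odot>\<^bsub>U k\<^esub> x')"
      using a x by (simp add: seq.smult)
    then have "to_limit i (a \<odot>\<^bsub>U i\<^esub> x) = to_limit k (a \<odot>\<^bsub>U k\<^esub> x')"
      using mn(1) a x'_in by (subst to_limit_eq_iff) (auto simp: U.smult_closed)
    then show ?thesis
      by simp
  qed
  have "{to_limit k (a \<odot>\<^bsub>U k\<^esub> x') | k x'. (k, x') \<in> to_limit i x} = {to_limit i (a \<odot>\<^bsub>U i\<^esub> x)}" (is "?S = _")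
  proof (rule subset_antisym)
    show "?S \<subseteq> {to_limit i (a \<odot>\<^bsub>U i\<^esub> x)}"
      using eq by blast
    show "{to_limit i (a \<odot>\<^bsub>U i\<^esub> x)} \<subseteq> ?S"
      using to_limit_self[OF x] by blast
  qed
  then show ?thesis
    by (simp add: limit_module_def)
qed

lemma limit_left_module: "left_module R limit"
proof (intro left_module.intro left_module_axioms.intro abelian_groupI ring_axioms)
  fix X Y Z assume X: "X \<in> carrier limit" and Y: "Y \<in> carrier limit" and Z: "Z \<in> carrier limit"
  obtain i x y z where eq: "X = to_limit i x" "Y = to_limit i y" "Z = to_limit i z"
    and mem: "x \<in> carrier (U i)" "y \<in> carrier (U i)" "z \<in> carrier (U i)"
    by (rule limit_common_part[OF X Y Z])
  show "(X \<oplus>\<^bsub>limit\<^esub> Y) \<oplus>\<^bsub>limit\<^esub> Z = X \<oplus>\<^bsub>limit\<^esub> (Y \<oplus>\<^bsub>limit\<^esub> Z)"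
    unfolding eq using mem by (simp add: limit_add U.M.a_assoc)
next
  fix X Y assume X: "X \<in> carrier limit" and Y: "Y \<in> carrier limit"
  obtain i x y where eq: "X = to_limit i x" "Y = to_limit i y"
    and mem: "x \<in> carrier (U i)" "y \<in> carrier (U i)"
    by (rule limit_common_part[OF X Y Y])
  show "X \<oplus>\<^bsub>limit\<^esub> Y \<in> carrier limit"
    unfolding eq using mem by (simp add: limit_add to_limit_closed)
  show "X \<oplus>\<^bsub>limit\<^esub> Y = Y \<oplus>\<^bsub>limit\<^esub> X"
    unfolding eq using mem by (simp add: limit_add U.M.a_comm)
  show "a \<odot>\<^bsub>limit\<^esub> (X \<oplus>\<^bsub>limit\<^esub> Y) = a \<odot>\<^bsub>limit\<^esub> X \<oplus>\<^bsub>limit\<^esub> a \<odot>\<^bsub>limit\<^esub> Y" if "a \<in> carrier R" for a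
    unfolding eq using mem that by (simp add: limit_add limit_smult U.smult_r_distr U.smult_closed)
next
  fix X assume X: "X \<in> carrier limit"
  obtain i x where eq: "X = to_limit i x" and mem: "x \<in> carrier (U i)"
    by (rule limit_common_part[OF X X X])
  show "\<zero>\<^bsub>limit\<^esub> \<oplus>\<^bsub>limit\<^esub> X = X"
    unfolding eq limit_zero[of i] using mem by (simp add: limit_add)
  show "\<exists>Y\<in>carrier limit. Y \<oplus>\<^bsub>limit\<^esub> X = \<zero>\<^bsub>limit\<^esub>"
    unfolding eq limit_zero[of i] using mem
    by (intro bexI[of _ "to_limit i (\<ominus>\<^bsub>U i\<^esub> x)"]) (simp_all add: limit_add U.M.l_neg to_limit_closed)
  show "\<one> \<odot>\<^bsub>limit\<^esub> X = X"
    unfolding eq using mem by (simp add: limit_smult U.smult_one)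
  fix a assume a: "a \<in> carrier R"
  show "a \<odot>\<^bsub>limit\<^esub> X \<in> carrier limit"
    unfolding eq using mem a by (simp add: limit_smult U.smult_closed to_limit_closed)
  fix b assume b: "b \<in> carrier R"
  show "(a \<oplus> b) \<odot>\<^bsub>limit\<^esub> X = a \<odot>\<^bsub>limit\<^esub> X \<oplus>\<^bsub>limit\<^esub> b \<odot>\<^bsub>limit\<^esub> X"
    unfolding eq using mem a b by (simp add: limit_add limit_smult U.smult_l_distr U.smult_closed)
  show "(a \<otimes> b) \<odot>\<^bsub>limit\<^esub> X = a \<odot>\<^bsub>limit\<^esub> (b \<odot>\<^bsub>limit\<^esub> X)"
    unfolding eq using mem a b by (simp add: limit_smult U.smult_assoc1 U.smult_closed)
qed (simp add: limit_zero[of 0] to_limit_closed)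

sublocale limit: plain_module R limit
  by (rule plain_module.intro[OF limit_left_module])

lemma to_limit_hom: "to_limit i \<in> module_hom R (U i) limit"
  by (rule module_homI) (simp_all add: to_limit_closed limit_add limit_smult)

sublocale to_limit: left_module_hom R "U i" limit "to_limit i" for i
  by (intro left_module_homI left_module limit_left_module to_limit_hom)

lemma limit_part_submodule: "submodule (limit_part U w i) R limit"
  unfolding limit_part_def by (rule to_limit.image_submodule[OF U.submodule_carrier])

end

locale module_sequence_endo = module_sequence R U w
  for R :: "('r, 'k) ring_scheme" (structure) and U :: "nat \<Rightarrow> ('r, 'm) module" and w +
  fixes v :: "nat \<Rightarrow> 'm \<Rightarrow> 'm"
  assumes v_hom: "v i \<in> module_hom R (U i) (U (Suc i))"
    and v_w: "x \<in> carrier (U i) \<Longrightarrow> v (Suc i) (w i x) = w (Suc i) (v i x)"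
begin

abbreviation v_limit where "v_limit \<equiv> limit_endo U w v"

sublocale v: left_module_hom R "U i" "U (Suc i)" "v i" for i
  by (intro left_module_homI left_module v_hom)

lemma v_seq_map:
  "x \<in> carrier (U i) \<Longrightarrow> seq_map w (Suc i) n (v i x) = v (i + n) (seq_map w i n x)"
  by (induction n) (simp_all add: v_w seq.closed)

lemma v_limit_to_limit:
  assumes x: "x \<in> carrier (U i)"
  shows "v_limit (to_limit i x) = to_limit (Suc i) (v i x)"
proof -
  have eq: "to_limit (Suc k) (v k x') = to_limit (Suc i) (v i x)" if x': "(k, x') \<in> to_limit i x" for k x'
  proof -
    from to_limit_mem[OF x'] obtain m n where mn: "i + m = k + n" "seq_map w i m x = seq_map w k n x'"
      and x'_in: "x' \<in> carrier (U k)" by blast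
    then have "seq_map w (Suc i) m (v i x) = seq_map w (Suc k) n (v k x')"
      using x by (simp add: v_seq_map)
    then have "to_limit (Suc i) (v i x) = to_limit (Suc k) (v k x')"
      using mn(1) x'_in by (subst to_limit_eq_iff) (auto simp: v.closed)
    then show ?thesis
      by simp
  qed
  have "{to_limit (Suc k) (v k x') | k x'. (k, x') \<in> to_limit i x} = {to_limit (Suc i) (v i x)}" (is "?S = _")
  proof (rule subset_antisym)
    show "?S \<subseteq> {to_limit (Suc i) (v i x)}"
      using eq by blast
    show "{to_limit (Suc i) (v i x)} \<subseteq> ?S"
      using to_limit_self[OF x] by blast
  qed
  then show ?thesis
    by (simp add: limit_endo_def)
qed

lemma v_limit_hom: "v_limit \<in> module_hom R limit limit"
proof (rule module_homI)
  fix X Y assume X: "X \<in> carrier limit" and Y: "Y \<in> carrier limit"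
  obtain i x y where eq: "X = to_limit i x" "Y = to_limit i y"
    and mem: "x \<in> carrier (U i)" "y \<in> carrier (U i)"
    by (rule limit_common_part[OF X Y Y])
  show "v_limit X \<in> carrier limit"
    unfolding eq using mem by (simp add: v_limit_to_limit v.closed to_limit_closed)
  show "v_limit (X \<oplus>\<^bsub>limit\<^esub> Y) = v_limit X \<oplus>\<^bsub>limit\<^esub> v_limit Y"
    unfolding eq using mem by (simp add: v_limit_to_limit limit_add v.closed v.add)
  show "v_limit (a \<odot>\<^bsub>limit\<^esub> X) = a \<odot>\<^bsub>limit\<^esub> v_limit X" if "a \<in> carrier R" for a
    unfolding eq using mem that
    by (simp add: v_limit_to_limit limit_smult v.closed v.smult U.smult_closed)
qed

sublocale v_limit: left_module_hom R limit limit v_limit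
  by (intro left_module_homI limit_left_module v_limit_hom)

end

section \<open>Ladders\<close>

context ladder
begin

lemma pushout_square: "x \<in> carrier (U i) \<Longrightarrow> v (Suc i) (w i x) = w (Suc i) (v i x)"
  using pushout[of i] by (simp add: is_pushout_def)

sublocale module_sequence_endo R U w v
  by (intro module_sequence_endo.intro module_sequence.intro module_sequence_axioms.intro
      module_sequence_endo_axioms.intro ring_axioms left_module w_hom v_hom pushout_square)

lemma U_Suc_Suc_cover:
  assumes "x \<in> carrier (U (Suc (Suc i)))"
  obtains y z where "y \<in> carrier (U (Suc i))" "z \<in> carrier (U (Suc i))"
    and "x = v (Suc i) y \<oplus>\<^bsub>U (Suc (Suc i))\<^esub> w (Suc i) z"
  using pushout_cover[OF pushout left_module left_module left_module v_hom w_hom assms] by blast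

lemma U_Suc_exact:
  assumes "y \<in> carrier (U (Suc i))" and "z \<in> carrier (U (Suc i))" and "v (Suc i) y = w (Suc i) z"
  obtains a where "a \<in> carrier (U i)" "y = w i a" "z = v i a"
  using pushout_exact[OF pushout left_module left_module left_module w_hom v_hom assms] by blast

text \<open>
  Exactness propagates injectivity: if \<open>w z = 0 = v 0\<close>, then \<open>0 = w a\<close> and \<open>z = v a\<close> for some \<open>a\<close>, and
  injectivity of the previous \<open>w\<close> gives \<open>a = 0\<close>.
\<close>

lemma w_inj: "inj_on (w i) (carrier (U i))"
proof (induction i)
  case 0
  show ?case
    by (rule w_0_inj)
next
  case (Suc i)
  show ?case
  proof (rule w.inj_onI)
    fix z assume z: "z \<in> carrier (U (Suc i))" "w (Suc i) z = \<zero>\<^bsub>U (Suc (Suc i))\<^esub>"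
    then have "v (Suc i) \<zero>\<^bsub>U (Suc i)\<^esub> = w (Suc i) z"
      by (simp add: v.zero)
    then obtain a where a: "a \<in> carrier (U i)" "\<zero>\<^bsub>U (Suc i)\<^esub> = w i a" "z = v i a"
      by (rule U_Suc_exact[OF U.M.zero_closed z(1)])
    then have "a = \<zero>\<^bsub>U i\<^esub>"
      using inj_onD[OF Suc, of a "\<zero>\<^bsub>U i\<^esub>"] w.zero[of i] by simp
    then show "z = \<zero>\<^bsub>U (Suc i)\<^esub>"
      using a(3) v.zero by simp
  qed
qed

lemma to_limit_inj_on: "inj_on (to_limit i) (carrier (U i))"
  by (rule to_limit_inj[OF w_inj])

abbreviation part where "part \<equiv> limit_part U w"

lemma part_subset: "part i \<subseteq> carrier limit"
  by (rule limit.submodule_subset[OF limit_part_submodule])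

lemma v_limit_part:
  assumes "X \<in> part i"
  shows "v_limit X \<in> part (Suc i)"
  using assms by (auto simp: limit_part_def v_limit_to_limit v.closed)

text \<open>
  Modulo \<open>U 1\<close>, the endomorphism is onto, one filtration step at a time: the pushout \<open>U (i + 2)\<close> is
  the sum of \<open>v (U (i + 1))\<close> and \<open>w (U (i + 1))\<close>, and the second summand is \<open>U (i + 1)\<close> again.
\<close>

lemma part_Suc_cover:
  assumes "X \<in> part (Suc i)"
  shows "\<exists>Y\<in>part i. \<exists>Z\<in>part (Suc 0). X = Z \<oplus>\<^bsub>limit\<^esub> v_limit Y"
  using assms
proof (induction i arbitrary: X)
  case 0
  have "X = X \<oplus>\<^bsub>limit\<^esub> v_limit \<zero>\<^bsub>limit\<^esub>"
    using 0 part_subset[of "Suc 0"] by (auto simp: v_limit.zero)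
  then show ?case
    using 0 limit.submodule_zero[OF limit_part_submodule, of 0] by auto
next
  case (Suc i)
  then obtain x where x: "x \<in> carrier (U (Suc (Suc i)))" "X = to_limit (Suc (Suc i)) x"
    by (auto simp: limit_part_def)
  obtain y z where y: "y \<in> carrier (U (Suc i))" and z: "z \<in> carrier (U (Suc i))"
    and eq: "x = v (Suc i) y \<oplus>\<^bsub>U (Suc (Suc i))\<^esub> w (Suc i) z"
    by (rule U_Suc_Suc_cover[OF x(1)])
  have y': "to_limit (Suc i) y \<in> part (Suc i)" and z': "to_limit (Suc i) z \<in> part (Suc i)"
    using y z by (auto simp: limit_part_def)
  from Suc.IH[OF z'] obtain Y Z where Y: "Y \<in> part i" and Z: "Z \<in> part (Suc 0)"
    and Z_eq: "to_limit (Suc i) z = Z \<oplus>\<^bsub>limit\<^esub> v_limit Y"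
    by blast
  have Y': "Y \<in> part (Suc i)"
    using Y limit_part_mono[of i "Suc i"] by auto
  note in_limit = subsetD[OF part_subset y'] subsetD[OF part_subset Y'] subsetD[OF part_subset Z]
  have "X = v_limit (to_limit (Suc i) y) \<oplus>\<^bsub>limit\<^esub> to_limit (Suc i) z"
    unfolding x(2) eq using y z
    by (simp add: to_limit.add v.closed w.closed v_limit_to_limit to_limit_w)
  also have "\<dots> = Z \<oplus>\<^bsub>limit\<^esub> v_limit (to_limit (Suc i) y \<oplus>\<^bsub>limit\<^esub> Y)"
    unfolding Z_eq using in_limit by (simp add: v_limit.add v_limit.closed limit.M.a_ac)
  finally show ?case
    using Z limit.submodule_add[OF limit_part_submodule y' Y'] by blast
qed

text \<open>
  Modulo \<open>U 0\<close>, the endomorphism is injective: by exactness of the pushout,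
  \<open>v y \<in> w (U (i + 1))\<close> forces \<open>y \<in> U (i + 1)\<close> to come from the previous stage, all the way
  down to \<open>U 0\<close>.
\<close>

lemma part_0_if_v_limit_part_1:
  assumes X: "X \<in> carrier limit" and v_X: "v_limit X \<in> part (Suc 0)"
  shows "X \<in> part 0"
proof -
  from X obtain i where "X \<in> part i"
    by (auto simp: limit_carrier)
  then show ?thesis
  proof (induction i)
    case (Suc i)
    from Suc.prems obtain y where y: "y \<in> carrier (U (Suc i))" "X = to_limit (Suc i) y"
      by (auto simp: limit_part_def)
    have "part (Suc 0) \<subseteq> part (Suc i)"
      by (rule limit_part_mono) simp
    with v_X obtain z where z: "z \<in> carrier (U (Suc i))" "v_limit X = to_limit (Suc i) z"
      by (auto simp: limit_part_def)
    have "to_limit (Suc (Suc i)) (v (Suc i) y) = to_limit (Suc (Suc i)) (w (Suc i) z)"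
      using y z by (simp add: v_limit_to_limit to_limit_w)
    then have "v (Suc i) y = w (Suc i) z"
      using y(1) z(1) by (intro inj_onD[OF to_limit_inj_on]) (auto simp: v.closed w.closed)
    then obtain a where "a \<in> carrier (U i)" "y = w i a"
      by (rule U_Suc_exact[OF y(1) z(1)])
    then have "X \<in> part i"
      using y(2) by (auto simp: limit_part_def to_limit_w)
    then show ?case
      by (rule Suc.IH)
  qed
qed

lemma v_limit_part_1_iff: "X \<in> carrier limit \<Longrightarrow> v_limit X \<in> part (Suc 0) \<longleftrightarrow> X \<in> part 0"
  using part_0_if_v_limit_part_1 v_limit_part[of X 0] by auto

lemma limit_cover:
  assumes "X \<in> carrier limit"
  shows "\<exists>Y\<in>carrier limit. \<exists>Z\<in>part (Suc 0). X = Z \<oplus>\<^bsub>limit\<^esub> v_limit Y"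
proof -
  from assms obtain i where "X \<in> part i"
    by (auto simp: limit_carrier)
  then have "X \<in> part (Suc i)"
    using limit_part_mono[of i "Suc i"] by auto
  from part_Suc_cover[OF this] show ?thesis
    using part_subset by blast
qed

end

section \<open>The endomorphism of the limit and its Pruefer module\<close>

context ladder
begin

text \<open>The kernel is contained in \<open>U 0\<close>, because \<open>v x = 0\<close> lies in \<open>U 1\<close>.\<close>

lemma v_limit_kernel:
  "to_limit 0 \<in> module_iso R (kernel_module (U 0) (U (Suc 0)) (v 0)) (kernel_module limit limit v_limit)"
proof (rule module_isoI)
  have "to_limit 0 ` a_kernel (U 0) (U (Suc 0)) (v 0) \<subseteq> a_kernel limit limit v_limit"
    by (auto simp: a_kernel_def' to_limit.closed v_limit_to_limit limit_zero[of "Suc 0"])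
  then show "to_limit 0 \<in> module_hom R (kernel_module (U 0) (U (Suc 0)) (v 0)) (kernel_module limit limit v_limit)"
    unfolding kernel_module_def
    by (intro module_hom_restrict to_limit_hom) (auto simp: a_kernel_def')
  show "inj_on (to_limit 0) (carrier (kernel_module (U 0) (U (Suc 0)) (v 0)))"
    by (rule inj_on_subset[OF to_limit_inj_on]) (auto simp: kernel_module_def a_kernel_def')
  fix X assume "X \<in> carrier (kernel_module limit limit v_limit)"
  then have X: "X \<in> carrier limit" "v_limit X = \<zero>\<^bsub>limit\<^esub>"
    by (simp_all add: kernel_module_def a_kernel_def')
  then have "X \<in> part 0"
    using limit.submodule_zero[OF limit_part_submodule] by (intro part_0_if_v_limit_part_1) auto
  then obtain x where x: "x \<in> carrier (U 0)" "X = to_limit 0 x"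
    by (auto simp: limit_part_def)
  with X(2) have "to_limit (Suc 0) (v 0 x) = to_limit (Suc 0) \<zero>\<^bsub>U (Suc 0)\<^esub>"
    by (simp add: v_limit_to_limit limit_zero[of "Suc 0"])
  then have "v 0 x = \<zero>\<^bsub>U (Suc 0)\<^esub>"
    by (rule inj_onD[OF to_limit_inj_on]) (simp_all add: v.closed x)
  with x show "\<exists>x\<in>carrier (kernel_module (U 0) (U (Suc 0)) (v 0)). X = to_limit 0 x"
    by (auto simp: kernel_module_def a_kernel_def')
qed

lemma v_limit_image_submodule: "submodule (v_limit ` carrier limit) R limit"
  by (rule v_limit.image_submodule[OF limit.submodule_carrier])

lemma v_image_submodule: "submodule (v i ` carrier (U i)) R (U (Suc i))"
  by (rule v.image_submodule[OF U.submodule_carrier])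

lemma w_image_submodule: "submodule (w i ` carrier (U i)) R (U (Suc i))"
  by (rule w.image_submodule[OF U.submodule_carrier])

text \<open>
  By \<open>part_0_if_v_limit_part_1\<close>, the part of the image of \<open>v\<close> inside \<open>U 1\<close> is \<open>v 0 (U 0)\<close>, and by
  \<open>limit_cover\<close> the submodule \<open>U 1\<close> meets all cosets of that image.
\<close>

lemma v_limit_cokernel:
  "induced_map limit (v_limit ` carrier limit) (to_limit (Suc 0)) \<in>
     module_iso R (cokernel_module (U 0) (U (Suc 0)) (v 0)) (cokernel_module limit limit v_limit)"
  unfolding cokernel_module_def
proof (rule to_limit.induced_map_iso[OF v_image_submodule v_limit_image_submodule])
  fix x assume x: "x \<in> carrier (U (Suc 0))"
  show "to_limit (Suc 0) x \<in> v_limit ` carrier limit \<longleftrightarrow> x \<in> v 0 ` carrier (U 0)"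
  proof
    assume "to_limit (Suc 0) x \<in> v_limit ` carrier limit"
    then obtain Y where Y: "Y \<in> carrier limit" "to_limit (Suc 0) x = v_limit Y"
      by blast
    have "to_limit (Suc 0) x \<in> part (Suc 0)"
      using x by (simp add: limit_part_def)
    with Y have "Y \<in> part 0"
      by (intro part_0_if_v_limit_part_1) simp_all
    then obtain y where y: "y \<in> carrier (U 0)" "Y = to_limit 0 y"
      by (auto simp: limit_part_def)
    with Y have "to_limit (Suc 0) x = to_limit (Suc 0) (v 0 y)"
      by (simp add: v_limit_to_limit)
    then have "x = v 0 y"
      by (rule inj_onD[OF to_limit_inj_on]) (simp_all add: x y v.closed)
    with y show "x \<in> v 0 ` carrier (U 0)"
      by blast
  next
    assume "x \<in> v 0 ` carrier (U 0)"
    then obtain y where "y \<in> carrier (U 0)" "x = v 0 y"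
      by blast
    then show "to_limit (Suc 0) x \<in> v_limit ` carrier limit"
      by (intro image_eqI[of _ _ "to_limit 0 y"]) (simp_all add: v_limit_to_limit to_limit.closed)
  qed
next
  fix X assume "X \<in> carrier limit"
  then obtain Y Z where Y: "Y \<in> carrier limit" and Z: "Z \<in> part (Suc 0)" and X: "X = Z \<oplus>\<^bsub>limit\<^esub> v_limit Y"
    using limit_cover by blast
  from Z obtain z where z: "z \<in> carrier (U (Suc 0))" "Z = to_limit (Suc 0) z"
    by (auto simp: limit_part_def)
  have "X = v_limit Y \<oplus>\<^bsub>limit\<^esub> to_limit (Suc 0) z"
    unfolding X z(2) using Y z(1) by (simp add: limit.M.a_comm v_limit.closed to_limit.closed)
  with Y z(1) show "\<exists>x\<in>carrier (U (Suc 0)). \<exists>b\<in>v_limit ` carrier limit. X = b \<oplus>\<^bsub>limit\<^esub> to_limit (Suc 0) x"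
    by blast
qed

abbreviation P0 where "P0 \<equiv> quotient_module limit (part 0)"
abbreviation P1 where "P1 \<equiv> quotient_module limit (part (Suc 0))"
abbreviation v_quot where "v_quot \<equiv> induced_map limit (part (Suc 0)) v_limit"
abbreviation projection where "projection \<equiv> induced_map limit (part (Suc 0)) (\<lambda>x. x)"

definition shift where "shift = inv_into (carrier P0) v_quot \<circ> projection"

abbreviation H where "H \<equiv> cokernel_module (U 0) (U (Suc 0)) (w 0)"

lemma v_quot_iso: "v_quot \<in> module_iso R P0 P1"
proof (rule v_limit.induced_map_iso[OF limit_part_submodule limit_part_submodule])
  show "\<exists>Y\<in>carrier limit. \<exists>Z\<in>part (Suc 0). X = Z \<oplus>\<^bsub>limit\<^esub> v_limit Y" if "X \<in> carrier limit" for X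
    using limit_cover[OF that] .
qed (rule v_limit_part_1_iff)

lemma v_quot_coset:
  assumes "X \<in> carrier limit"
  shows "v_quot (part 0 +>\<^bsub>limit\<^esub> X) = part (Suc 0) +>\<^bsub>limit\<^esub> v_limit X"
  using assms v_limit_part
  by (intro v_limit.induced_map_coset[OF limit_part_submodule limit_part_submodule]) auto

sublocale ident: left_module_hom R limit limit "\<lambda>x. x"
  by (intro left_module_homI limit_left_module module_hom_id)

lemma part_0_subset: "(\<lambda>x. x) ` part 0 \<subseteq> part (Suc 0)"
  using limit_part_mono[of 0 "Suc 0"] by simp

lemma projection_hom: "projection \<in> module_hom R P0 P1"
  by (rule ident.induced_map_hom[OF limit_part_submodule limit_part_submodule part_0_subset])

lemma projection_coset:
  "X \<in> carrier limit \<Longrightarrow> projection (part 0 +>\<^bsub>limit\<^esub> X) = part (Suc 0) +>\<^bsub>limit\<^esub> X"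
  by (rule ident.induced_map_coset[OF limit_part_submodule limit_part_submodule part_0_subset])

lemma P0_left_module: "left_module R P0"
  by (rule limit.quotient_left_module[OF limit_part_submodule])

lemma shift_hom: "shift \<in> module_hom R P0 P0"
  unfolding shift_def
  by (rule module_hom_comp[OF projection_hom module_iso_hom[OF module_iso_inv[OF P0_left_module v_quot_iso]]])

sublocale shift: left_module_hom R P0 P0 shift
  by (intro left_module_homI P0_left_module shift_hom)

lemma P0_coset: "X \<in> carrier limit \<Longrightarrow> part 0 +>\<^bsub>limit\<^esub> X \<in> carrier P0"
  by (simp add: quotient_carrier)

lemma P0_coset_zero_iff: "X \<in> carrier limit \<Longrightarrow> part 0 +>\<^bsub>limit\<^esub> X = \<zero>\<^bsub>P0\<^esub> \<longleftrightarrow> X \<in> part 0"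
  by (simp add: quotient_zero limit.coset_zero_iff[OF limit_part_submodule])

text \<open>
  This describes the map completely, as every element of the limit is of the form \<open>Z + v Y\<close> by
  \<open>limit_cover\<close>: modulo \<open>U 0\<close>, the map discards \<open>Z\<close> and undoes \<open>v\<close>.
\<close>

lemma shift_coset:
  assumes Y: "Y \<in> carrier limit" and Z: "Z \<in> part (Suc 0)"
  shows "shift (part 0 +>\<^bsub>limit\<^esub> (Z \<oplus>\<^bsub>limit\<^esub> v_limit Y)) = part 0 +>\<^bsub>limit\<^esub> Y"
proof -
  have Z': "Z \<in> carrier limit"
    using Z part_subset by blast
  have "projection (part 0 +>\<^bsub>limit\<^esub> (Z \<oplus>\<^bsub>limit\<^esub> v_limit Y)) = part (Suc 0) +>\<^bsub>limit\<^esub> (Z \<oplus>\<^bsub>limit\<^esub> v_limit Y)"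
    using Y Z' by (intro projection_coset) (simp add: v_limit.closed)
  also have "\<dots> = v_quot (part 0 +>\<^bsub>limit\<^esub> Y)"
    using Y Z by (simp add: v_quot_coset limit.coset_absorb[OF limit_part_submodule] v_limit.closed)
  finally show ?thesis
    unfolding shift_def comp_def
    using inv_into_f_f[OF bij_betw_imp_inj_on[OF module_iso_bij[OF v_quot_iso]] P0_coset[OF Y]] by simp
qed

lemma shift_surj: "shift ` carrier P0 = carrier P0"
proof
  show "shift ` carrier P0 \<subseteq> carrier P0"
    using shift.closed by blast
  show "carrier P0 \<subseteq> shift ` carrier P0"
  proof
    fix y assume "y \<in> carrier P0"
    then obtain Y where Y: "Y \<in> carrier limit" "y = part 0 +>\<^bsub>limit\<^esub> Y"
      by (auto simp: quotient_carrier)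
    have "y = shift (part 0 +>\<^bsub>limit\<^esub> (\<zero>\<^bsub>limit\<^esub> \<oplus>\<^bsub>limit\<^esub> v_limit Y))"
      using shift_coset[OF Y(1) limit.submodule_zero[OF limit_part_submodule]] Y(2) by simp
    then show "y \<in> shift ` carrier P0"
      using Y(1) by (auto intro!: imageI P0_coset simp: v_limit.closed)
  qed
qed

text \<open>
  Each application lowers the filtration by one, as \<open>U (i + 1) = U 1 + v (U i)\<close>. The extra step kills
  nothing new; it keeps the exponent positive also for \<open>i = 0\<close>.
\<close>

lemma shift_nilpotent_on_part: "X \<in> part i \<Longrightarrow> (shift ^^ Suc i) (part 0 +>\<^bsub>limit\<^esub> X) = \<zero>\<^bsub>P0\<^esub>"
proof (induction i arbitrary: X)
  case 0
  then have "part 0 +>\<^bsub>limit\<^esub> X = \<zero>\<^bsub>P0\<^esub>"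
    by (simp add: P0_coset_zero_iff[OF subsetD[OF part_subset]])
  then show ?case
    by (simp add: shift.zero)
next
  case (Suc i)
  from part_Suc_cover[OF Suc.prems] obtain Y Z where Y: "Y \<in> part i" and Z: "Z \<in> part (Suc 0)"
    and X: "X = Z \<oplus>\<^bsub>limit\<^esub> v_limit Y"
    by blast
  have "shift (part 0 +>\<^bsub>limit\<^esub> X) = part 0 +>\<^bsub>limit\<^esub> Y"
    unfolding X by (rule shift_coset[OF subsetD[OF part_subset Y] Z])
  then show ?case
    using Suc.IH[OF Y] by (subst funpow_Suc_right) simp
qed

lemma shift_locally_nilpotent: "locally_nilpotent P0 shift"
  unfolding locally_nilpotent_def
proof
  fix x assume "x \<in> carrier P0"
  then obtain X i where X: "X \<in> part i" "x = part 0 +>\<^bsub>limit\<^esub> X"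
    by (auto simp: quotient_carrier limit_carrier)
  show "\<exists>t\<ge>1. (shift ^^ t) x = \<zero>\<^bsub>P0\<^esub>"
    using shift_nilpotent_on_part[OF X(1)] X(2) by (intro exI[of _ "Suc i"]) simp
qed

text \<open>
  The class of \<open>Z + v Y\<close> is sent to zero if and only if \<open>Y \<in> U 0\<close>, that is, \<open>v Y \<in> U 1\<close>. So the kernel is
  \<open>U 1/U 0\<close>.
\<close>

lemma shift_kernel: "a_kernel P0 P0 shift = (\<lambda>X. part 0 +>\<^bsub>limit\<^esub> X) ` part (Suc 0)"
proof (rule subset_antisym)
  show "a_kernel P0 P0 shift \<subseteq> (\<lambda>X. part 0 +>\<^bsub>limit\<^esub> X) ` part (Suc 0)"
  proof
    fix x assume "x \<in> a_kernel P0 P0 shift"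
    then obtain X where X: "X \<in> carrier limit" "x = part 0 +>\<^bsub>limit\<^esub> X" "shift x = \<zero>\<^bsub>P0\<^esub>"
      by (auto simp: a_kernel_def' quotient_carrier)
    obtain Y Z where Y: "Y \<in> carrier limit" and Z: "Z \<in> part (Suc 0)" and eq: "X = Z \<oplus>\<^bsub>limit\<^esub> v_limit Y"
      using limit_cover[OF X(1)] by blast
    have "part 0 +>\<^bsub>limit\<^esub> Y = \<zero>\<^bsub>P0\<^esub>"
      using X(3) shift_coset[OF Y Z] unfolding X(2) eq by simp
    then have "v_limit Y \<in> part (Suc 0)"
      using Y by (simp add: P0_coset_zero_iff v_limit_part)
    then have "X \<in> part (Suc 0)"
      unfolding eq by (rule limit.submodule_add[OF limit_part_submodule Z])
    then show "x \<in> (\<lambda>X. part 0 +>\<^bsub>limit\<^esub> X) ` part (Suc 0)"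
      unfolding X(2) by (rule imageI)
  qed
  show "(\<lambda>X. part 0 +>\<^bsub>limit\<^esub> X) ` part (Suc 0) \<subseteq> a_kernel P0 P0 shift"
  proof (rule image_subsetI)
    fix Z assume Z: "Z \<in> part (Suc 0)"
    then have Z': "Z \<in> carrier limit"
      using part_subset by blast
    then have "shift (part 0 +>\<^bsub>limit\<^esub> Z) = part 0 +>\<^bsub>limit\<^esub> \<zero>\<^bsub>limit\<^esub>"
      using shift_coset[OF limit.M.zero_closed Z] by (simp add: v_limit.zero)
    then show "part 0 +>\<^bsub>limit\<^esub> Z \<in> a_kernel P0 P0 shift"
      using Z' by (simp add: a_kernel_def' P0_coset quotient_zero limit.coset_zero[OF limit_part_submodule])
  qed
qed

lemma H_left_module: "left_module R H"
  unfolding cokernel_module_def by (rule U.quotient_left_module[OF w_image_submodule])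

lemma to_limit_part_0_iff:
  assumes x: "x \<in> carrier (U (Suc 0))"
  shows "to_limit (Suc 0) x \<in> part 0 \<longleftrightarrow> x \<in> w 0 ` carrier (U 0)"
proof
  assume "to_limit (Suc 0) x \<in> part 0"
  then obtain a where a: "a \<in> carrier (U 0)" "to_limit (Suc 0) x = to_limit 0 a"
    by (auto simp: limit_part_def)
  then have "to_limit (Suc 0) x = to_limit (Suc 0) (w 0 a)"
    by (simp add: to_limit_w)
  then have "x = w 0 a"
    by (rule inj_onD[OF to_limit_inj_on]) (simp_all add: x a w.closed)
  with a(1) show "x \<in> w 0 ` carrier (U 0)"
    by blast
qed (auto simp: to_limit_w limit_part_def)

lemma H_iso_shift_kernel:
  "induced_map (limit\<lparr>carrier := part (Suc 0)\<rparr>) (part 0) (to_limit (Suc 0)) \<in>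
     module_iso R H (kernel_module P0 P0 shift)"
proof -
  let ?L = "limit\<lparr>carrier := part (Suc 0)\<rparr>"
  interpret restricted: left_module_hom R "U (Suc 0)" ?L "to_limit (Suc 0)"
    by (intro left_module_homI left_module limit.submodule_left_module limit_part_submodule module_homI)
      (simp_all add: limit_part_def to_limit.add to_limit.smult)
  have "kernel_module P0 P0 shift = quotient_module ?L (part 0)"
    by (simp add: kernel_module_def shift_kernel quotient_restrict)
  moreover have "induced_map ?L (part 0) (to_limit (Suc 0)) \<in> module_iso R H (quotient_module ?L (part 0))"
    unfolding cokernel_module_def
  proof (rule restricted.induced_map_iso[OF w_image_submodule])
    show "submodule (part 0) R ?L"
      by (rule limit.submodule_restrict[OF limit_part_submodule limit_part_submodule]) (rule limit_part_mono, simp)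
    show "to_limit (Suc 0) x \<in> part 0 \<longleftrightarrow> x \<in> w 0 ` carrier (U 0)" if "x \<in> carrier (U (Suc 0))" for x
      by (rule to_limit_part_0_iff[OF that])
    fix X assume "X \<in> carrier ?L"
    then obtain x where x: "x \<in> carrier (U (Suc 0))" "X = to_limit (Suc 0) x"
      by (auto simp: limit_part_def)
    then have "X = \<zero>\<^bsub>limit\<^esub> \<oplus>\<^bsub>?L\<^esub> to_limit (Suc 0) x"
      by (simp add: to_limit.closed)
    with x(1) show "\<exists>x\<in>carrier (U (Suc 0)). \<exists>b\<in>part 0. X = b \<oplus>\<^bsub>?L\<^esub> to_limit (Suc 0) x"
      using limit.submodule_zero[OF limit_part_submodule] by blast
  qed
  ultimately show ?thesis
    by simp
qed

lemma P0_nontrivial: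
  assumes "carrier H \<noteq> {\<zero>\<^bsub>H\<^esub>}"
  shows "carrier P0 \<noteq> {\<zero>\<^bsub>P0\<^esub>}"
proof
  assume trivial: "carrier P0 = {\<zero>\<^bsub>P0\<^esub>}"
  have "x \<in> w 0 ` carrier (U 0)" if x: "x \<in> carrier (U (Suc 0))" for x
  proof -
    have "to_limit (Suc 0) x \<in> part 0"
      using P0_coset[OF to_limit.closed[OF x]] P0_coset_zero_iff[OF to_limit.closed[OF x]]
      unfolding trivial by simp
    then show ?thesis
      by (simp add: to_limit_part_0_iff x)
  qed
  then have "w 0 ` carrier (U 0) +>\<^bsub>U (Suc 0)\<^esub> x = \<zero>\<^bsub>H\<^esub>" if "x \<in> carrier (U (Suc 0))" for x
    using U.coset_zero_iff[OF w_image_submodule that] that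
    by (simp add: cokernel_module_def quotient_zero)
  then have "carrier H \<subseteq> {\<zero>\<^bsub>H\<^esub>}"
    unfolding cokernel_module_def quotient_carrier by (intro image_subsetI) simp
  moreover have "\<zero>\<^bsub>H\<^esub> \<in> carrier H"
    using left_module.submodule_zero[OF H_left_module left_module.submodule_carrier[OF H_left_module]] .
  ultimately show False
    using assms by blast
qed

lemma shift_kernel_left_module: "left_module R (kernel_module P0 P0 shift)"
  unfolding kernel_module_def
  by (rule shift.M.submodule_left_module[OF shift.kernel_submodule])

lemma P0_pruefer:
  assumes "carrier H \<noteq> {\<zero>\<^bsub>H\<^esub>}" and "finite_length R H"
  shows "pruefer_module R P0 shift"
  unfolding pruefer_module_def
  using P0_left_module P0_nontrivial[OF assms(1)] shift_hom shift_surj shift_locally_nilpotent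
    finite_length_iso[OF assms(2) shift_kernel_left_module H_iso_shift_kernel]
  by simp

lemma v_limit_kernel_isomorphic:
  "module_isomorphic R (kernel_module limit limit v_limit) (kernel_module (U 0) (U (Suc 0)) (v 0))"
proof (rule module_isomorphic_sym)
  show "left_module R (kernel_module (U 0) (U (Suc 0)) (v 0))"
    unfolding kernel_module_def by (rule U.submodule_left_module[OF v.kernel_submodule])
qed (use v_limit_kernel in \<open>auto simp: module_isomorphic_def\<close>)

lemma v_limit_cokernel_isomorphic:
  "module_isomorphic R (cokernel_module limit limit v_limit) (cokernel_module (U 0) (U (Suc 0)) (v 0))"
proof (rule module_isomorphic_sym)
  show "left_module R (cokernel_module (U 0) (U (Suc 0)) (v 0))"
    unfolding cokernel_module_def by (rule U.quotient_left_module[OF v_image_submodule])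
qed (use v_limit_cokernel in \<open>auto simp: module_isomorphic_def\<close>)

lemma shift_kernel_isomorphic: "module_isomorphic R (kernel_module P0 P0 shift) H"
  by (rule module_isomorphic_sym[OF H_left_module])
    (use H_iso_shift_kernel in \<open>auto simp: module_isomorphic_def\<close>)

end

theorem mainTheorem1:
  fixes R :: "('r, 'k) ring_scheme"
    and U :: "nat \<Rightarrow> ('r, 'm) module"
    and w v :: "nat \<Rightarrow> 'm \<Rightarrow> 'm"
  defines "H \<equiv> cokernel_module (U 0) (U 1) (w 0)"
    and "K \<equiv> kernel_module (U 0) (U 1) (v 0)"
    and "Q \<equiv> cokernel_module (U 0) (U 1) (v 0)"
    and "Uinf \<equiv> limit_module U w"
    and "U\<^sub>0 \<equiv> limit_part U w 0"
    and "U\<^sub>1 \<equiv> limit_part U w 1"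
    and "vinf \<equiv> limit_endo U w v"
  defines "P\<^sub>0 \<equiv> quotient_module Uinf U\<^sub>0"
    and "P\<^sub>1 \<equiv> quotient_module Uinf U\<^sub>1"
    and "v' \<equiv> induced_map Uinf U\<^sub>1 vinf"
    and "p \<equiv> induced_map Uinf U\<^sub>1 (\<lambda>x. x)"
  defines "\<phi> \<equiv> inv_into (carrier P\<^sub>0) v' \<circ> p"
  assumes "ladder R U w v"
  shows
    \<comment> \<open>(a)\<close>
    "(left_module R Uinf
      \<and> vinf \<in> module_hom R Uinf Uinf
      \<and> (\<forall>i. \<forall>x\<in>carrier (U i). vinf (limit_map U w i x) = limit_map U w (Suc i) (v i x))
      \<and> module_isomorphic R (kernel_module Uinf Uinf vinf) K
      \<and> module_isomorphic R (cokernel_module Uinf Uinf vinf) Q)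
    \<and> \<comment> \<open>(b)\<close>
     (submodule U\<^sub>0 R Uinf \<and> submodule U\<^sub>1 R Uinf
      \<and> v' \<in> module_iso R P\<^sub>0 P\<^sub>1
      \<and> (\<forall>x\<in>carrier Uinf. v' (U\<^sub>0 +>\<^bsub>Uinf\<^esub> x) = U\<^sub>1 +>\<^bsub>Uinf\<^esub> vinf x)
      \<and> p \<in> module_hom R P\<^sub>0 P\<^sub>1
      \<and> (\<forall>x\<in>carrier Uinf. p (U\<^sub>0 +>\<^bsub>Uinf\<^esub> x) = U\<^sub>1 +>\<^bsub>Uinf\<^esub> x)
      \<and> \<phi> \<in> module_hom R P\<^sub>0 P\<^sub>0
      \<and> (carrier H \<noteq> {\<zero>\<^bsub>H\<^esub>} \<and> finite_length R H \<longrightarrow>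
           pruefer_module R P\<^sub>0 \<phi>
           \<and> module_isomorphic R (kernel_module P\<^sub>0 P\<^sub>0 \<phi>) H))"
proof -
  interpret ladder R U w v
    by fact
  have shift: "\<phi> = shift"
    unfolding \<phi>_def v'_def p_def P\<^sub>0_def Uinf_def U\<^sub>0_def U\<^sub>1_def vinf_def shift_def by simp
  show ?thesis
    unfolding shift
    unfolding H_def K_def Q_def v'_def p_def P\<^sub>0_def P\<^sub>1_def Uinf_def U\<^sub>0_def U\<^sub>1_def vinf_def One_nat_def
    using limit_left_module v_limit_hom v_limit_to_limit v_limit_kernel_isomorphic
      v_limit_cokernel_isomorphic limit_part_submodule v_quot_iso v_quot_coset projection_hom
      projection_coset shift_hom P0_pruefer shift_kernel_isomorphic
    by (intro conjI ballI allI impI) (elim conjE | assumption | blast)+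
qed

end
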